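(* Let $X=\prod_{i=1}^d X_i\subseteq\mathbb{R}^n$ with each $X_i\subseteq\mathbb{R}^{n_i}$ nonempty, closed and convex, $\sum_{i=1}^d n_i=n$, and suppose $X$ is bounded, with $\|x\|\le M$ for all $x\in X$ and some $M>0$. Let $f:\mathbb{R}^n\to\mathbb{R}$ be convex with bounded subgradients over $X$: $\|\tilde\nabla f(x)\|\le C_f$ for all $\tilde\nabla f(x)\in\partial f(x)$, $x\in X$, where $C_f>0$. Let $F:\mathbb{R}^n\to\mathbb{R}^n$ be continuous, monotone and bounded over $X$, with $\|F(x)\|\le C_F$ for all $x\in X$, where $C_F>0$. Suppose the optimal solution set of the problem of minimizing $f(x)$ subject to $x\in\mathrm{SOL}(X,F)$ is nonempty. Let $\{\bar x_k\}$ be generated by the aRB-IRG algorithm (described in the context) with block selection probabilities $p_i>0$, $\sum_{i=1}^d p_i=1$, $p_{\min}=\min_i p_i$, with parameter $0\le r<1$, and with, for all $k\ge 0$, $$\gamma_k=\frac{\gamma_0}{\sqrt{k+1}},\qquad \eta_k=\frac{\eta_0}{(k+1)^b},$$ where $\gamma_0>0$, $\eta_0>0$ and $0<b<0.5$. Then the following hold. (i) Let $x^*$ be an optimal solution of the problem of minimizing $f(x)$ subject to $x\in\mathrm{SOL}(X,F)$. Then for all integers $N\ge 2^{\frac{2}{1-r}}-1$, $$\mathsf{E}[f(\bar x_N)]-f(x^* )\le \frac{2-r}{p_{\min}\,\eta_0}\left(\frac{4M^2}{\gamma_0}+\frac{\gamma_0\left(C_F^2+\eta_0^2C_f^2\right)}{0.5-0.5r+b}\right)\frac{1}{(N+1)^{0.5-b}}.$$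 (ii) For all integers $N\ge 2^{\frac{2}{1-r}}-1$, $$\mathsf{E}[\mathrm{GAP}(\bar x_N)]\le \frac{2-r}{p_{\min}}\left(\frac{4M^2}{\gamma_0}+\frac{\gamma_0\left(C_F^2+\eta_0^2C_f^2\right)}{0.5-0.5r}+\frac{2p_{\min}C_fM\eta_0}{1-0.5r-b}\right)\frac{1}{(N+1)^{b}}.$$
   Context: Notation. $\|\cdot\|$ is the Euclidean norm; a vector $x\in\mathbb{R}^n$ is partitioned into blocks $x=(x^{(1)};\ldots;x^{(d)})$ with $x^{(i)}\in\mathbb{R}^{n_i}$; $F_i(x)\in\mathbb{R}^{n_i}$ is the $i$-th block of $F(x)$. $\mathcal{P}_S$ is the Euclidean projection onto a closed convex set $S$. $\tilde\nabla f$ denotes a subgradient mapping of $f$, $\tilde\nabla f(x)\in\partial f(x)$, and $\tilde\nabla_i f(x)$ its $i$-th block. $F$ is monotone on $X$ if $(F(x)-F(y))^T(x-y)\ge 0$ for all $x,y\in X$. $\mathrm{SOL}(X,F)$ is the set of solutions of the variational inequality $\mathrm{VI}(X,F)$: all $x\in X$ with $F(x)^T(y-x)\ge 0$ for all $y\in X$. The dual gap function is $\mathrm{GAP}(x)=\sup_{y\in X}F(y)^T(x-y)$ for $x\in X$. Algorithm aRB-IRG. Input: a random initial point $x_0\in X$, $\bar x_0:=x_0$, positive sequences $\{\gamma_k\}$ (stepsizes) and $\{\eta_k\}$ (regularization parameters), a scalar $0\le r<1$, $S_0:=\gamma_0^r$. The block indices $i_0,i_1,\ldots$ are independent, identically distributed,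 independent of $x_0$, with $\mathrm{Prob}(i_k=i)=p_i$ for $i\in\{1,\ldots,d\}$. For $k=0,1,\ldots$: $$x_{k+1}^{(i)}:=\begin{cases}\mathcal{P}_{X_{i_k}}\!\left(x_k^{(i_k)}-\gamma_k\left(F_{i_k}(x_k)+\eta_k\tilde\nabla_{i_k}f(x_k)\right)\right)& i=i_k,\\ x_k^{(i)}& i\ne i_k,\end{cases}$$ $$S_{k+1}:=S_k+\gamma_{k+1}^r,\qquad \bar x_{k+1}:=\frac{S_k\bar x_k+\gamma_{k+1}^r x_{k+1}}{S_{k+1}}.$$ Expectations are over $x_0$ and the $i_k$; all random quantities are understood to be measurable. *)

theory Defs
  imports "HOL-Analysis.Analysis" "HOL-Probability.Probability"
begin

text \<open>
  Block structure.  A map \<open>blk :: 'n \<Rightarrow> 'd\<close> assigns to every coordinate of \<open>real ^ 'n\<close> the block it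
  belongs to; there are \<open>CARD('d)\<close> blocks, and block \<open>i\<close> has dimension
  \<open>card {j. blk j = i}\<close>.  The space of the vectors of block \<open>i\<close> is represented isometrically by
  the coordinate subspace \<open>block_space blk i\<close> of \<open>real ^ 'n\<close>, and the \<open>i\<close>-th block of a vector by
  the vector with all coordinates outside the block set to zero.
\<close>

definition block_space :: "('n::finite \<Rightarrow> 'd) \<Rightarrow> 'd \<Rightarrow> (real ^ 'n) set" where
  "block_space blk i = {v. \<forall>j. blk j \<noteq> i \<longrightarrow> v $ j = 0}"

definition block :: "('n::finite \<Rightarrow> 'd) \<Rightarrow> 'd \<Rightarrow> real ^ 'n \<Rightarrow> real ^ 'n" where
  "block blk i x = (\<chi> j. if blk j = i then x $ j else 0)"

definition block_prod :: "('n::finite \<Rightarrow> 'd) \<Rightarrow> ('d \<Rightarrow> (real ^ 'n) set) \<Rightarrow> (real ^ 'n) set" where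
  "block_prod blk Xs = {x. \<forall>i. block blk i x \<in> Xs i}"

definition subdifferential :: "('a::real_inner \<Rightarrow> real) \<Rightarrow> 'a \<Rightarrow> 'a set" where
  "subdifferential f x = {g. \<forall>y. f y \<ge> f x + g \<bullet> (y - x)}"

definition monotone_map_on :: "'a::real_inner set \<Rightarrow> ('a \<Rightarrow> 'a) \<Rightarrow> bool" where
  "monotone_map_on X F \<longleftrightarrow> (\<forall>x\<in>X. \<forall>y\<in>X. (F x - F y) \<bullet> (x - y) \<ge> 0)"

definition SOL :: "'a::real_inner set \<Rightarrow> ('a \<Rightarrow> 'a) \<Rightarrow> 'a set" where
  "SOL X F = {x \<in> X. \<forall>y\<in>X. F x \<bullet> (y - x) \<ge> 0}"

definition optimal_solutions :: "('a::real_inner \<Rightarrow> real) \<Rightarrow> 'a set \<Rightarrow> ('a \<Rightarrow> 'a) \<Rightarrow> 'a set" where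
  "optimal_solutions f X F = {x. is_arg_min f (\<lambda>z. z \<in> SOL X F) x}"

text \<open>
  The supremum is taken in the reals.  It is the intended one whenever \<open>X\<close> is nonempty and
  \<open>X\<close> and \<open>F ` X\<close> are bounded.
\<close>

definition GAP :: "'a::real_inner set \<Rightarrow> ('a \<Rightarrow> 'a) \<Rightarrow> 'a \<Rightarrow> real" where
  "GAP X F x = (SUP y\<in>X. F y \<bullet> (x - y))"

text \<open>
  The algorithm for one realization \<open>x0\<close> of the initial point and one realization
  \<open>is\<close> of the sequence of block indices; \<open>sg\<close> is the subgradient mapping,
  \<open>\<gamma>\<close> the stepsizes and \<open>\<eta>\<close> the regularization parameters.
\<close>

primrec arb_irg_iter ::
  "('n::finite \<Rightarrow> 'd) \<Rightarrow> ('d \<Rightarrow> (real ^ 'n) set) \<Rightarrow> (real ^ 'n \<Rightarrow> real ^ 'n) \<Rightarrow> (real ^ 'n \<Rightarrow> real ^ 'n)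
    \<Rightarrow> (nat \<Rightarrow> real) \<Rightarrow> (nat \<Rightarrow> real) \<Rightarrow> real ^ 'n \<Rightarrow> (nat \<Rightarrow> 'd) \<Rightarrow> nat \<Rightarrow> real ^ 'n" where
  "arb_irg_iter blk Xs F sg \<gamma> \<eta> x0 is 0 = x0"
| "arb_irg_iter blk Xs F sg \<gamma> \<eta> x0 is (Suc k) =
    (let x = arb_irg_iter blk Xs F sg \<gamma> \<eta> x0 is k;
         i = is k;
         z = closest_point (Xs i)
               (block blk i x - \<gamma> k *\<^sub>R (block blk i (F x) + \<eta> k *\<^sub>R block blk i (sg x)))
     in (\<chi> j. if blk j = i then z $ j else x $ j))"

primrec avg_weight :: "(nat \<Rightarrow> real) \<Rightarrow> real \<Rightarrow> nat \<Rightarrow> real" where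
  "avg_weight \<gamma> r 0 = \<gamma> 0 powr r"
| "avg_weight \<gamma> r (Suc k) = avg_weight \<gamma> r k + \<gamma> (Suc k) powr r"

primrec weighted_avg ::
  "(nat \<Rightarrow> real) \<Rightarrow> real \<Rightarrow> (nat \<Rightarrow> 'a::real_vector) \<Rightarrow> nat \<Rightarrow> 'a" where
  "weighted_avg \<gamma> r x 0 = x 0"
| "weighted_avg \<gamma> r x (Suc k) =
    (avg_weight \<gamma> r k *\<^sub>R weighted_avg \<gamma> r x k + \<gamma> (Suc k) powr r *\<^sub>R x (Suc k))
      /\<^sub>R avg_weight \<gamma> r (Suc k)"

text \<open>
  The sigma-algebra generated by \<open>x0\<close> and the first \<open>k\<close> block indices.  The subgradient at the
  \<open>k\<close>-th iterate should be measurable with respect to it: a non-Borel subgradient mapping could be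
  measurable with respect to \<open>P\<close> alone and still depend on the next block index.
\<close>

definition history ::
  "'w measure \<Rightarrow> ('w \<Rightarrow> 'a::topological_space) \<Rightarrow> (nat \<Rightarrow> 'w \<Rightarrow> 'd) \<Rightarrow> nat \<Rightarrow> 'w measure" where
  "history P x0 i k =
    vimage_algebra (space P) (\<lambda>\<omega>. (x0 \<omega>, \<lambda>l\<in>{..<k}. i l \<omega>))
      (borel \<Otimes>\<^sub>M (\<Pi>\<^sub>M l\<in>{..<k}. count_space UNIV))"

text \<open>
  Independence of two random variables with values in different types, as independence of the
  sigma-algebras they generate (the library's \<open>indep_var\<close> needs equal value types).
\<close>

definition indep_of ::
  "'w measure \<Rightarrow> 'a measure \<Rightarrow> ('w \<Rightarrow> 'a) \<Rightarrow> 'b measure \<Rightarrow> ('w \<Rightarrow> 'b) \<Rightarrow> bool" where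
  "indep_of P A X B Y \<longleftrightarrow>
    prob_space.indep_set P (sets (vimage_algebra (space P) X A)) (sets (vimage_algebra (space P) Y B))"

end

theory Submission
  imports Defs
begin

text \<open>
  One step of the algorithm contracts the distance weighted by \<open>1 / p j\<close> up to the inner product of
  \<open>x k - y\<close> with the unbiased estimate of \<open>G k = F (x k) + \<eta> k * sg (x k)\<close> carried by the drawn block
  and a term of order \<open>(\<gamma> k)\<^sup>2\<close>. Weighting the steps by \<open>a k\<close> with \<open>a k / \<gamma> k\<close> nondecreasing and
  telescoping bounds the weighted sum of the \<open>G k \<bullet> (x k - y)\<close>, uniformly in \<open>y\<close>, by a random variable
  with small expectation. Monotonicity of \<open>F\<close> then turns the choice \<open>a k = \<gamma> k powr r / \<eta> k\<close> with \<open>y\<close>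
  optimal into the bound on the objective, and \<open>a k = \<gamma> k powr r\<close> with \<open>y\<close> arbitrary into the bound
  on the gap.
\<close>

subsection \<open>Sums of powers and telescoping sums\<close>

text \<open>The drawn block gives an unbiased estimate of \<open>G k\<close> only given the past.
  Therefore every quantity of step \<open>k\<close> is built for each possible block
  \<open>j\<close>, kept measurable with respect to the history, and the drawn index is substituted
  last; its independence from the history then averages the error over \<open>p\<close>. The rates
  come from comparing exponents of \<open>N + 1\<close> with the total weight, which has order
  \<open>1 - r / 2\<close>. With \<open>a k = \<gamma> k powr r\<close>, both the potential and the
  accumulated variance have order \<open>1 / 2 - r / 2\<close>. Dividing by \<open>\<eta> k\<close>
  raises this by \<open>b\<close>, which leaves \<open>0.5 - b\<close> for the objective. In the gap
  nothing is divided by \<open>\<eta> k\<close>, but the regularization is a bias of order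
  \<open>1 - r / 2 - b\<close>; since \<open>b < 1 / 2\<close> it dominates and leaves the rate
  \<open>b\<close>. So a larger \<open>b\<close> improves the gap bound at the expense of the
  objective bound.\<close>

lemma powr_le_tangent:
  fixes x y s :: real
  assumes "0 < x" "0 < y" "0 \<le> s" "s \<le> 1"
  shows "x powr s \<le> y powr s + s * y powr (s - 1) * (x - y)"
proof -
  \<comment> \<open>Weighted AM-GM. Multiplied by \<open>y powr (s - 1)\<close> it becomes the
    tangent inequality at \<open>y\<close> for a concave power.\<close>
  have "x powr s * y powr (1 - s) \<le> s * x + (1 - s) * y"
    using Youngs_inequality_0[of s "1 - s" x y] assms by simp
  then have "x powr s * y powr (1 - s) * y powr (s - 1) \<le> (s * x + (1 - s) * y) * y powr (s - 1)"
    by (rule mult_right_mono) simp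
  moreover have "y powr (1 - s) * y powr (s - 1) = 1" "y * y powr (s - 1) = y powr s"
    using assms(2) by (simp_all add: powr_mult_base flip: powr_add)
  ultimately show ?thesis
    by (simp add: algebra_simps)
qed

lemma sum_powr_minus_le:
  fixes \<beta> :: real
  assumes "0 \<le> \<beta>" "\<beta> < 1"
  shows "(\<Sum>k\<le>N. (real k + 1) powr (-\<beta>)) \<le> (real N + 1) powr (1 - \<beta>) / (1 - \<beta>)"
proof (induction N)
  case 0
  then show ?case using assms by simp
next
  case (Suc N)
  have "(real N + 1) powr (1 - \<beta>) \<le> (real N + 2) powr (1 - \<beta>) - (1 - \<beta>) * (real N + 2) powr (-\<beta>)"
    using powr_le_tangent[of "real N + 1" "real N + 2" "1 - \<beta>"] assms by simp
  from divide_right_mono[OF this, of "1 - \<beta>"]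
  have "(real N + 1) powr (1 - \<beta>) / (1 - \<beta>) + (real N + 2) powr (-\<beta>)
      \<le> (real N + 2) powr (1 - \<beta>) / (1 - \<beta>)"
    using assms by (simp add: diff_divide_distrib)
  with Suc show ?case by (simp add: add.commute)
qed

text \<open>The opposite comparison, with the integral from 1 to \<open>N + 2\<close>: here the
  tangent is taken at the left endpoint of each unit interval.\<close>

lemma sum_powr_minus_ge:
  fixes \<alpha> :: real
  assumes "0 \<le> \<alpha>" "\<alpha> < 1"
  shows "((real N + 2) powr (1 - \<alpha>) - 1) / (1 - \<alpha>) \<le> (\<Sum>k\<le>N. (real k + 1) powr (-\<alpha>))"
proof (induction N)
  case 0
  have "2 powr (1 - \<alpha>) \<le> 1 + (1 - \<alpha>)"
    using powr_le_tangent[of 2 1 "1 - \<alpha>"] assms by simp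
  then show ?case using assms by (simp add: field_simps)
next
  case (Suc N)
  have "(real N + 3) powr (1 - \<alpha>) \<le> (real N + 2) powr (1 - \<alpha>) + (1 - \<alpha>) * (real N + 2) powr (-\<alpha>)"
    using powr_le_tangent[of "real N + 3" "real N + 2" "1 - \<alpha>"] assms by simp
  from divide_right_mono[OF this, of "1 - \<alpha>"]
  have "((real N + 3) powr (1 - \<alpha>) - 1) / (1 - \<alpha>)
      \<le> ((real N + 2) powr (1 - \<alpha>) - 1) / (1 - \<alpha>) + (real N + 2) powr (-\<alpha>)"
    using assms by (simp add: diff_divide_distrib add_divide_distrib)
  with Suc show ?case by (simp add: add.commute)
qed

text \<open>The threshold on \<open>N\<close> says that \<open>(N + 1) powr (1 - \<alpha>)\<close>
  is at least 2, so subtracting 1 costs at most half of it.\<close>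

lemma sum_powr_minus_ge_half:
  fixes \<alpha> :: real
  assumes "0 \<le> \<alpha>" "\<alpha> < 1" "2 powr (1 / (1 - \<alpha>)) \<le> real N + 1"
  shows "(real N + 1) powr (1 - \<alpha>) / (2 * (1 - \<alpha>)) \<le> (\<Sum>k\<le>N. (real k + 1) powr (-\<alpha>))"
proof -
  have "2 = (2 powr (1 / (1 - \<alpha>))) powr (1 - \<alpha>)"
    using assms by (simp add: powr_powr)
  also have "\<dots> \<le> (real N + 1) powr (1 - \<alpha>)"
    using assms by (intro powr_mono2) auto
  finally have "(real N + 1) powr (1 - \<alpha>) / 2 \<le> (real N + 1) powr (1 - \<alpha>) - 1"
    by simp
  also have "\<dots> \<le> (real N + 2) powr (1 - \<alpha>) - 1"
    using assms by (simp add: powr_mono2)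
  finally have "(real N + 1) powr (1 - \<alpha>) / 2 / (1 - \<alpha>) \<le> ((real N + 2) powr (1 - \<alpha>) - 1) / (1 - \<alpha>)"
    using assms by (intro divide_right_mono) auto
  with sum_powr_minus_ge[OF assms(1,2), of N] show ?thesis
    by simp
qed

text \<open>Abel summation: each nonnegative increment of \<open>c\<close> multiplies a value of
  \<open>E\<close> that is at most \<open>B\<close>. The induction carries the boundary term with
  \<open>E (Suc N)\<close>, which is dropped only at the end.\<close>

lemma sum_telescope_weighted_le:
  fixes c E :: "nat \<Rightarrow> real"
  assumes "mono c" "0 \<le> c 0" and E: "\<And>k. 0 \<le> E k" "\<And>k. E k \<le> B"
  shows "(\<Sum>k\<le>N. c k * (E k - E (Suc k))) \<le> c N * B"
proof -
  have c: "0 \<le> c k" "c k \<le> c (Suc k)" for k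
    using assms(1,2) by (auto simp: mono_iff_le_Suc intro: order_trans[OF _ monoD[OF assms(1)]])
  have "(\<Sum>k\<le>N. c k * (E k - E (Suc k))) \<le> c N * (B - E (Suc N))"
  proof (induction N)
    case 0
    show ?case using mult_left_mono[OF E(2) c(1), of 0 0] by (simp add: algebra_simps)
  next
    case (Suc N)
    have "c N * (B - E (Suc N)) \<le> c (Suc N) * (B - E (Suc N))"
      using c E(2) by (intro mult_right_mono) auto
    with Suc show ?case by (simp add: algebra_simps)
  qed
  also have "\<dots> \<le> c N * B"
    using c E(1) by (intro mult_left_mono) auto
  finally show ?thesis .
qed

lemma sum_power2_le: "(s + t)\<^sup>2 \<le> 2 * (s\<^sup>2 + t\<^sup>2)" for s t :: real
  using sum_squares_bound[of s t] by (simp add: power2_sum)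

subsection \<open>Weighted averages\<close>

lemma avg_weight_eq_sum: "avg_weight \<gamma> r N = (\<Sum>k\<le>N. \<gamma> k powr r)"
  by (induction N) auto

lemma avg_weight_pos: "(\<And>k. 0 < \<gamma> k) \<Longrightarrow> 0 < avg_weight \<gamma> r N"
  unfolding avg_weight_eq_sum by (intro sum_pos) (auto simp: order_less_imp_not_eq2)

lemma scaleR_weighted_avg:
  assumes "\<And>k. 0 < \<gamma> k"
  shows "avg_weight \<gamma> r N *\<^sub>R weighted_avg \<gamma> r x N = (\<Sum>k\<le>N. \<gamma> k powr r *\<^sub>R x k)"
proof (induction N)
  case 0
  then show ?case by simp
next
  case (Suc N)
  have "avg_weight \<gamma> r (Suc N) *\<^sub>R weighted_avg \<gamma> r x (Suc N)
      = avg_weight \<gamma> r N *\<^sub>R weighted_avg \<gamma> r x N + \<gamma> (Suc N) powr r *\<^sub>R x (Suc N)"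
    using avg_weight_pos[of \<gamma> r "Suc N", OF assms] by simp
  with Suc show ?case by simp
qed

lemma weighted_avg_eq_sum:
  assumes "\<And>k. 0 < \<gamma> k"
  shows "weighted_avg \<gamma> r x N = (\<Sum>k\<le>N. (\<gamma> k powr r / avg_weight \<gamma> r N) *\<^sub>R x k)"
proof -
  have "weighted_avg \<gamma> r x N = (1 / avg_weight \<gamma> r N) *\<^sub>R (avg_weight \<gamma> r N *\<^sub>R weighted_avg \<gamma> r x N)"
    using avg_weight_pos[of \<gamma> r N, OF assms] by simp
  then show ?thesis
    unfolding scaleR_weighted_avg[OF assms] by (simp add: scaleR_sum_right)
qed

lemma weighted_avg_in_convex:
  assumes "\<And>k. 0 < \<gamma> k" "convex S" "\<And>k. x k \<in> S"
  shows "weighted_avg \<gamma> r x N \<in> S"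
  unfolding weighted_avg_eq_sum[OF assms(1)] using assms avg_weight_pos[of \<gamma> r N]
  by (intro convex_sum) (auto simp: avg_weight_eq_sum simp flip: sum_divide_distrib intro!: divide_nonneg_pos)

lemma convex_on_weighted_avg_le:
  assumes "\<And>k. 0 < \<gamma> k" "convex_on UNIV f"
  shows "avg_weight \<gamma> r N * f (weighted_avg \<gamma> r x N) \<le> (\<Sum>k\<le>N. \<gamma> k powr r * f (x k))"
proof -
  note S = avg_weight_pos[of \<gamma> r N, OF assms(1)]
  have "f (weighted_avg \<gamma> r x N) \<le> (\<Sum>k\<le>N. \<gamma> k powr r / avg_weight \<gamma> r N * f (x k))"
    unfolding weighted_avg_eq_sum[OF assms(1)] using assms S
    by (intro convex_on_sum[where C=UNIV])
      (auto simp: avg_weight_eq_sum simp flip: sum_divide_distrib intro!: divide_nonneg_pos)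
  then have "avg_weight \<gamma> r N * f (weighted_avg \<gamma> r x N)
      \<le> avg_weight \<gamma> r N * (\<Sum>k\<le>N. \<gamma> k powr r / avg_weight \<gamma> r N * f (x k))"
    using S by (intro mult_left_mono) auto
  also have "\<dots> = (\<Sum>k\<le>N. \<gamma> k powr r * f (x k))"
    using S by (simp add: sum_distrib_left)
  finally show ?thesis .
qed

subsection \<open>Blocks and projections\<close>

lemma block_nth: "block blk j v $ l = (if blk l = j then v $ l else 0)"
  by (simp add: block_def)

lemma linear_block: "linear (block blk j)"
  by (rule linearI) (auto simp: block_def vec_eq_iff)

lemmas block_diff = linear_diff[OF linear_block]
  and block_add = linear_add[OF linear_block]
  and block_scaleR = linear_scale[OF linear_block]

lemma block_eq_self_iff: "block blk j v = v \<longleftrightarrow> v \<in> block_space blk j"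
  by (auto simp: block_def block_space_def vec_eq_iff)

lemma block_block: "block blk j (block blk l v) = (if j = l then block blk j v else 0)"
  by (auto simp: block_def vec_eq_iff)

lemma sum_block: "(\<Sum>j\<in>UNIV. block blk j v) = v" for blk :: "'n::finite \<Rightarrow> 'd::finite"
  by (simp add: vec_eq_iff block_nth)

lemma inner_block_left: "block blk j v \<bullet> w = block blk j v \<bullet> block blk j w"
  by (auto simp: inner_vec_def block_nth intro!: sum.cong)

lemma sum_norm_block: "(\<Sum>j\<in>UNIV. (norm (block blk j v))\<^sup>2) = (norm v)\<^sup>2"
  for blk :: "'n::finite \<Rightarrow> 'd::finite"
proof -
  have "(\<Sum>j\<in>UNIV. (norm (block blk j v))\<^sup>2) = (\<Sum>j\<in>UNIV. block blk j v \<bullet> v)"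
    by (simp add: power2_norm_eq_inner inner_block_left[of _ _ _ v])
  also have "\<dots> = (norm v)\<^sup>2"
    unfolding inner_sum_left[symmetric] sum_block by (simp add: power2_norm_eq_inner)
  finally show ?thesis .
qed

lemma norm_block_le: "norm (block blk j v) \<le> norm v"
  by (intro norm_le_componentwise_cart) (simp add: block_nth)

lemma block_prod_nonempty:
  assumes "\<And>j. Xs j \<subseteq> block_space blk j" "\<And>j. Xs j \<noteq> {}"
  shows "block_prod blk Xs \<noteq> {}"
proof -
  define v where "v j = (SOME z. z \<in> Xs j)" for j
  have v: "v j \<in> Xs j" for j
    using assms(2)[of j] by (simp add: v_def some_in_eq)
  \<comment> \<open>Each coordinate lies in exactly one block, so the chosen points are glued by
    reading coordinate \<open>l\<close> from the point chosen for its own block.\<close>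
  have "block blk j (\<chi> l. v (blk l) $ l) = v j" for j
    using v[of j] assms(1)[of j] by (auto simp: vec_eq_iff block_nth block_space_def subset_eq)
  with v have "(\<chi> l. v (blk l) $ l) \<in> block_prod blk Xs"
    by (simp add: block_prod_def)
  then show ?thesis by blast
qed

lemma block_prod_eq_Inter: "block_prod blk Xs = (\<Inter>j. block blk j -` Xs j)"
  by (auto simp: block_prod_def)

lemma closed_block_prod: "(\<And>j. closed (Xs j)) \<Longrightarrow> closed (block_prod blk Xs)"
  unfolding block_prod_eq_Inter
  by (intro closed_INT ballI closed_vimage linear_continuous_on linear_conv_bounded_linear[THEN iffD1] linear_block)

lemma convex_block_prod: "(\<And>j. convex (Xs j)) \<Longrightarrow> convex (block_prod blk Xs)"
  unfolding block_prod_eq_Inter by (intro convex_INT convex_linear_vimage linear_block)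

lemma norm_closest_point_diff_le:
  fixes S :: "'a::euclidean_space set"
  assumes "convex S" "closed S" "y \<in> S"
  shows "norm (closest_point S z - y) \<le> norm (z - y)"
  using closest_point_lipschitz[OF assms(1,2), of z y] assms(3)
  by (auto simp: closest_point_self dist_norm)

lemma norm_diff_scaleR_power2:
  fixes a b :: "'a::real_inner"
  shows "(norm (a - c *\<^sub>R b))\<^sup>2 = (norm a)\<^sup>2 - 2 * c * (b \<bullet> a) + c\<^sup>2 * (norm b)\<^sup>2"
  unfolding power2_norm_eq_inner inner_diff inner_scaleR_left inner_scaleR_right inner_commute[of a b]
  by (simp add: algebra_simps power2_eq_square)

lemma closest_point_measurable:
  fixes S :: "'a::euclidean_space set"
  assumes "convex S" "closed S" "S \<noteq> {}" "g \<in> borel_measurable N"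
  shows "(\<lambda>\<omega>. closest_point S (g \<omega>)) \<in> borel_measurable N"
  using measurable_compose[OF assms(4) borel_measurable_continuous_onI[OF continuous_on_closest_point[OF assms(1-3)]]] .

lemma block_measurable:
  assumes "g \<in> borel_measurable N"
  shows "(\<lambda>\<omega>. block blk j (g \<omega>)) \<in> borel_measurable N"
  using linear_block
  by (intro measurable_compose[OF assms] borel_measurable_continuous_onI linear_continuous_on)
    (simp add: linear_conv_bounded_linear)

subsection \<open>Independence of the next block index from the history\<close>

text \<open>That the history is coarser than \<open>P\<close> is phrased through the identity map,
  so that composition transfers measurability.\<close>

lemma id_measurable_history:
  assumes "x0 \<in> borel_measurable P" "\<And>l. i l \<in> P \<rightarrow>\<^sub>M count_space UNIV"
  shows "(\<lambda>\<omega>. \<omega>) \<in> P \<rightarrow>\<^sub>M history P x0 i k"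
  unfolding history_def using assms
  by (intro measurable_vimage_algebra2) (auto intro!: measurable_restrict)

lemma space_history [simp]: "space (history P x0 i k) = space P"
  by (simp add: history_def)

lemma history_pair_measurable:
  "(\<lambda>\<omega>. (x0 \<omega>, \<lambda>l\<in>{..<k}. i l \<omega>))
    \<in> history P x0 i k \<rightarrow>\<^sub>M borel \<Otimes>\<^sub>M (\<Pi>\<^sub>M l\<in>{..<k}. count_space UNIV)"
  unfolding history_def
  by (intro measurable_vimage_algebra1) (auto simp: space_pair_measure space_PiM)

lemma x0_measurable_history: "x0 \<in> borel_measurable (history P x0 i k)"
  using measurable_compose[OF history_pair_measurable measurable_fst] by simp

lemma index_measurable_history:
  assumes "l < k"
  shows "i l \<in> history P x0 i k \<rightarrow>\<^sub>M count_space UNIV"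
  using measurable_compose[OF measurable_compose[OF history_pair_measurable measurable_snd]
      measurable_component_singleton[of l "{..<k}"]] assms
  by simp

lemma measurable_history_mono:
  assumes "g \<in> history P x0 i k \<rightarrow>\<^sub>M N" "k \<le> m"
  shows "g \<in> history P x0 i m \<rightarrow>\<^sub>M N"
proof -
  have "(\<lambda>\<omega>. \<omega>) \<in> history P x0 i m \<rightarrow>\<^sub>M history P x0 i k"
    unfolding history_def[of P x0 i k] using assms(2)
    by (intro measurable_vimage_algebra2 measurable_Pair x0_measurable_history measurable_restrict
        index_measurable_history) auto
  from measurable_compose[OF this assms(1)] show ?thesis .
qed

context prob_space
begin

text \<open>For \<open>A\<close> an event of \<open>x0\<close>, \<open>B\<close> of the earlier
  indices and \<open>C\<close> of the index \<open>k\<close>, independence of \<open>x0\<close> from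
  the sequence and of the indices among themselves factor the probability of the triple intersection
  completely; regrouping separates \<open>C\<close> from the rectangle formed by \<open>A\<close>
  and \<open>B\<close>. The rectangles form an intersection-stable generator of the history, so a
  Dynkin argument extends the product rule.\<close>

lemma indep_set_history_index:
  fixes x0 :: "'a \<Rightarrow> 'b::topological_space" and i :: "nat \<Rightarrow> 'a \<Rightarrow> 'd"
  assumes x0: "x0 \<in> borel_measurable M"
    and i: "indep_vars (\<lambda>_. count_space UNIV) i UNIV"
    and x0_indep: "indep_of M borel x0 (\<Pi>\<^sub>M k\<in>UNIV. count_space UNIV) (\<lambda>\<omega> k. i k \<omega>)"
  shows "indep_set {i k -` C \<inter> space M | C. True} (sets (history M x0 i k))"
proof -
  let ?S = "\<Pi>\<^sub>M k\<in>UNIV. count_space (UNIV :: 'd set)"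
  let ?T = "\<Pi>\<^sub>M l\<in>{..<k}. count_space (UNIV :: 'd set)"
  let ?past = "\<lambda>\<omega>. \<lambda>l\<in>{..<k}. i l \<omega>"
  let ?G = "{x0 -` A \<inter> space M \<inter> (?past -` B \<inter> space M) | A B. A \<in> sets borel \<and> B \<in> sets ?T}"
  let ?H = "{i k -` C \<inter> space M | C. True}"
  have i_meas: "i l \<in> M \<rightarrow>\<^sub>M count_space UNIV" for l
    using i by (auto simp: indep_vars_def)
  have past_meas: "?past \<in> M \<rightarrow>\<^sub>M ?T"
    using i_meas by (intro measurable_restrict) auto
  have x0_i: "prob (x0 -` A \<inter> space M \<inter> ((\<lambda>\<omega> k. i k \<omega>) -` D \<inter> space M))
      = prob (x0 -` A \<inter> space M) * prob ((\<lambda>\<omega> k. i k \<omega>) -` D \<inter> space M)"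
    if "A \<in> sets borel" "D \<in> sets ?S" for A D
    using x0_indep that unfolding indep_of_def by (intro indep_setD) (auto intro: in_vimage_algebra)
  have past_i: "prob (?past -` B \<inter> space M \<inter> (i k -` C \<inter> space M))
      = prob (?past -` B \<inter> space M) * prob (i k -` C \<inter> space M)" if B: "B \<in> sets ?T" for B C
  proof -
    \<comment> \<open>The index sets \<open>{..<k}\<close> and \<open>{k}\<close> are disjoint; the
      event on \<open>i k\<close> is recovered as a cylinder over the single coordinate.\<close>
    have "indep_var ?T ?past (\<Pi>\<^sub>M l\<in>{k}. count_space UNIV) (\<lambda>\<omega>. \<lambda>l\<in>{k}. i l \<omega>)"
      by (rule indep_var_restrict[OF i]) auto
    moreover have "(\<lambda>y. y k) -` C \<inter> space (\<Pi>\<^sub>M l\<in>{k}. count_space UNIV)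
        \<in> sets (\<Pi>\<^sub>M l\<in>{k}. count_space (UNIV :: 'd set))"
      by (rule measurable_sets[OF measurable_component_singleton[of k "{k}"]]) auto
    ultimately show ?thesis
      using indep_varD[OF _ B, of ?past "\<Pi>\<^sub>M l\<in>{k}. count_space UNIV" "\<lambda>\<omega>. \<lambda>l\<in>{k}. i l \<omega>"
          "(\<lambda>y. y k) -` C \<inter> space (\<Pi>\<^sub>M l\<in>{k}. count_space UNIV)"]
      by (simp add: vimage_def Int_def space_PiM conj_ac)
  qed
  have H_G: "prob (c \<inter> a) = prob c * prob a" if a: "a \<in> ?G" and c: "c \<in> ?H" for a c
  proof -
    obtain A B where A: "A \<in> sets borel" and B: "B \<in> sets ?T"
      and a_eq: "a = x0 -` A \<inter> space M \<inter> (?past -` B \<inter> space M)"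
      using a by blast
    obtain C where c_eq: "c = i k -` C \<inter> space M"
      using c by blast
    have restr: "(\<lambda>y. restrict y {..<k}) \<in> ?S \<rightarrow>\<^sub>M ?T"
      by (rule measurable_restrict_subset) auto
    have eval: "(\<lambda>y. y k) \<in> ?S \<rightarrow>\<^sub>M count_space UNIV"
      by (rule measurable_component_singleton) auto
    have D1: "(\<lambda>y. restrict y {..<k}) -` B \<inter> space ?S \<in> sets ?S"
      by (rule measurable_sets[OF restr B])
    moreover have "(\<lambda>y. y k) -` C \<inter> space ?S \<in> sets ?S"
      by (rule measurable_sets[OF eval]) auto
    \<comment> \<open>\<open>x0_indep\<close> speaks only of the whole index sequence, so the past
      alone (\<open>D1\<close>) and the past together with the present (\<open>D2\<close>) are both
      written as events of that sequence.\<close>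
    ultimately have D2: "((\<lambda>y. restrict y {..<k}) -` B \<inter> space ?S) \<inter> ((\<lambda>y. y k) -` C \<inter> space ?S)
        \<in> sets ?S"
      by (rule sets.Int)
    have pre1: "(\<lambda>\<omega> k. i k \<omega>) -` ((\<lambda>y. restrict y {..<k}) -` B \<inter> space ?S) \<inter> space M
        = ?past -` B \<inter> space M"
      by (auto simp: space_PiM)
    have pre2: "(\<lambda>\<omega> k. i k \<omega>) -` (((\<lambda>y. restrict y {..<k}) -` B \<inter> space ?S) \<inter>
        ((\<lambda>y. y k) -` C \<inter> space ?S)) \<inter> space M = ?past -` B \<inter> space M \<inter> c"
      by (auto simp: space_PiM c_eq)
    have "prob (a \<inter> c) = prob (x0 -` A \<inter> space M \<inter> (?past -` B \<inter> space M \<inter> c))"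
      by (simp add: a_eq Int_assoc)
    also have "\<dots> = prob (x0 -` A \<inter> space M) * (prob (?past -` B \<inter> space M) * prob c)"
      using x0_i[OF A D2] past_i[OF B, of C] unfolding pre2 by (simp add: c_eq)
    also have "\<dots> = prob a * prob c"
      using x0_i[OF A D1] unfolding pre1 by (simp add: a_eq)
    finally show ?thesis
      by (simp add: Int_commute mult.commute)
  qed
  have "indep_set ?H ?G"
    using x0 past_meas i_meas by (intro indep_setI H_G) (auto intro!: sets.Int measurable_sets)
  moreover have "Int_stable ?G"
  proof (rule Int_stableI)
    fix a a' assume "a \<in> ?G" "a' \<in> ?G"
    then obtain A B A' B' where "A \<in> sets borel" "B \<in> sets ?T" "A' \<in> sets borel" "B' \<in> sets ?T"
      "a = x0 -` A \<inter> space M \<inter> (?past -` B \<inter> space M)"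
      "a' = x0 -` A' \<inter> space M \<inter> (?past -` B' \<inter> space M)"
      by blast
    then show "a \<inter> a' \<in> ?G"
      by (intro CollectI exI[of _ "A \<inter> A'"] exI[of _ "B \<inter> B'"]) auto
  qed
  moreover have "Int_stable ?H"
  proof (rule Int_stableI)
    fix a a' assume "a \<in> ?H" "a' \<in> ?H"
    then obtain C C' where "a = i k -` C \<inter> space M" "a' = i k -` C' \<inter> space M"
      by blast
    then show "a \<inter> a' \<in> ?H"
      by (intro CollectI exI[of _ "C \<inter> C'"]) auto
  qed
  ultimately have "indep_set (sigma_sets (space M) ?H) (sigma_sets (space M) ?G)"
    by (intro indep_set_sigma_sets)
  \<comment> \<open>A rectangle with one trivial side is an event of \<open>x0\<close> alone or of
    the past alone; hence both maps, and their pair, are measurable for the sigma-algebra that the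
    rectangles generate.\<close>
  moreover have "sets (history M x0 i k) \<subseteq> sigma_sets (space M) ?G"
  proof -
    have G: "?G \<subseteq> Pow (space M)"
      by auto
    have "x0 \<in> borel_measurable (sigma (space M) ?G)"
    proof (rule measurableI)
      fix A :: "'b set" assume "A \<in> sets borel"
      then have "x0 -` A \<inter> space M \<in> ?G"
        using sets.top[of ?T] by (intro CollectI exI[of _ A] exI[of _ "space ?T"]) (auto simp: space_PiM)
      then show "x0 -` A \<inter> space (sigma (space M) ?G) \<in> sets (sigma (space M) ?G)"
        using G by auto
    qed auto
    moreover have "?past \<in> sigma (space M) ?G \<rightarrow>\<^sub>M ?T"
    proof (rule measurableI)
      fix B assume "B \<in> sets ?T"
      then have "?past -` B \<inter> space M \<in> ?G"
        by (intro CollectI exI[of _ UNIV] exI[of _ B]) auto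
      then show "?past -` B \<inter> space (sigma (space M) ?G) \<in> sets (sigma (space M) ?G)"
        using G by auto
    qed (auto simp: space_PiM)
    ultimately have "sets (history M x0 i k) \<subseteq> sets (sigma (space M) ?G)"
      unfolding history_def using G by (intro sets_image_in_sets measurable_Pair) auto
    then show ?thesis
      using G by simp
  qed
  ultimately show ?thesis
    unfolding indep_set_def
    by (elim indep_sets_mono_sets) (auto split: bool.split intro: sigma_sets.Basic)
qed

text \<open>This does the work of conditioning on the history. Splitting over the finitely many
  values of the index gives products of an indicator of \<open>i k\<close> with a history-measurable
  \<open>Z j\<close>, and the expectation of each product factors.\<close>

lemma expectation_at_index:
  fixes x0 :: "'a \<Rightarrow> 'b::topological_space" and i :: "nat \<Rightarrow> 'a \<Rightarrow> 'd::finite"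
  assumes x0: "x0 \<in> borel_measurable M"
    and i: "indep_vars (\<lambda>_. count_space UNIV) i UNIV"
    and x0_indep: "indep_of M borel x0 (\<Pi>\<^sub>M k\<in>UNIV. count_space UNIV) (\<lambda>\<omega> k. i k \<omega>)"
    and Z: "\<And>j. Z j \<in> borel_measurable (history M x0 i k)" "\<And>j. integrable M (Z j)"
  shows "integrable M (\<lambda>\<omega>. Z (i k \<omega>) \<omega>)"
    and "expectation (\<lambda>\<omega>. Z (i k \<omega>) \<omega>)
      = expectation (\<lambda>\<omega>. \<Sum>j\<in>UNIV. prob {\<omega> \<in> space M. i k \<omega> = j} * Z j \<omega>)"
proof -
  have i_meas: "i l \<in> M \<rightarrow>\<^sub>M count_space UNIV" for l
    using i by (auto simp: indep_vars_def)
  let ?I = "\<lambda>j \<omega>. indicator {j} (i k \<omega>) :: real"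
  have I_meas: "?I j \<in> borel_measurable M" for j
    using i_meas by (intro measurable_compose[OF i_meas]) auto
  have I: "integrable M (?I j)" "expectation (?I j) = prob {\<omega> \<in> space M. i k \<omega> = j}" for j
  proof -
    have eq: "?I j \<omega> = indicator {\<omega> \<in> space M. i k \<omega> = j} \<omega>" if "\<omega> \<in> space M" for \<omega>
      using that by (simp add: indicator_def)
    show "integrable M (?I j)"
      using I_meas by (intro integrable_const_bound[of _ 1]) auto
    show "expectation (?I j) = prob {\<omega> \<in> space M. i k \<omega> = j}"
      by (subst Bochner_Integration.integral_cong[OF refl eq]) (auto intro: arg_cong[where f=prob])
  qed
  have indep: "indep_var borel (?I j) borel (Z j)" for j
    unfolding indep_var_eq
  proof (intro conjI)
    show "random_variable borel (Z j)"
      using measurable_compose[OF id_measurable_history[OF x0 i_meas] Z(1)] by simp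
    have "{Z j -` A \<inter> space M |A. A \<in> sets borel} \<subseteq> sets (history M x0 i k)"
      using measurable_sets[OF Z(1)] by auto
    then have "sigma_sets (space M) {Z j -` A \<inter> space M |A. A \<in> sets borel} \<subseteq> sets (history M x0 i k)"
      using sets.sigma_sets_subset[of _ "history M x0 i k"] by simp
    moreover have "sigma_sets (space M) {?I j -` A \<inter> space M |A. A \<in> sets borel} \<subseteq> {i k -` C \<inter> space M | C. True}"
    proof -
      have "{?I j -` A \<inter> space M |A. A \<in> sets borel}
          \<subseteq> sets (vimage_algebra (space M) (i k) (count_space UNIV))"
      proof clarify
        fix A :: "real set"
        have "?I j -` A \<inter> space M = i k -` (indicator {j} -` A) \<inter> space M"
          by auto
        then show "?I j -` A \<inter> space M \<in> sets (vimage_algebra (space M) (i k) (count_space UNIV))"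
          by (simp add: in_vimage_algebra)
      qed
      then show ?thesis
        using sets.sigma_sets_subset[of _ "vimage_algebra (space M) (i k) (count_space UNIV)"]
        by (simp add: sets_vimage_algebra2)
    qed
    moreover have "indep_set {i k -` C \<inter> space M | C. True} (sets (history M x0 i k))"
      by (rule indep_set_history_index[OF x0 i x0_indep])
    ultimately show "indep_set (sigma_sets (space M) {?I j -` A \<inter> space M |A. A \<in> sets borel})
        (sigma_sets (space M) {Z j -` A \<inter> space M |A. A \<in> sets borel})"
      unfolding indep_set_def
      by (elim indep_sets_mono_sets) (auto split: bool.split)
  qed (fact I_meas)
  have split: "Z (i k \<omega>) \<omega> = (\<Sum>j\<in>UNIV. ?I j \<omega> * Z j \<omega>)" for \<omega>
    by (simp add: indicator_def if_distrib sum.delta cong: if_cong)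
  show "integrable M (\<lambda>\<omega>. Z (i k \<omega>) \<omega>)"
    unfolding split by (intro Bochner_Integration.integrable_sum indep_var_integrable indep I Z)
  show "expectation (\<lambda>\<omega>. Z (i k \<omega>) \<omega>)
      = expectation (\<lambda>\<omega>. \<Sum>j\<in>UNIV. prob {\<omega> \<in> space M. i k \<omega> = j} * Z j \<omega>)"
    unfolding split
    by (subst (1 2) Bochner_Integration.integral_sum)
      (simp_all add: Z I indep_var_integrable[OF indep] indep_var_lebesgue_integral[OF indep])
qed

end

subsection \<open>One run of the algorithm\<close>

text \<open>The objective and the monotonicity of \<open>F\<close> enter only in the two expectation
  bounds at the end of the locale; before that, \<open>sg\<close> is just a bounded direction that
  is measurable along the path.\<close>

locale arb_irg = prob_space P for P :: "'w measure" +
  fixes blk :: "'n::finite \<Rightarrow> 'd::finite"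
    and Xs :: "'d \<Rightarrow> (real ^ 'n) set"
    and F sg :: "real ^ 'n \<Rightarrow> real ^ 'n"
    and M Cf CF pmin :: real
    and \<gamma> \<eta> :: "nat \<Rightarrow> real"
    and p :: "'d \<Rightarrow> real"
    and x0 :: "'w \<Rightarrow> real ^ 'n"
    and i :: "nat \<Rightarrow> 'w \<Rightarrow> 'd"
    and x :: "'w \<Rightarrow> nat \<Rightarrow> real ^ 'n"
  assumes Xs: "\<And>j. Xs j \<subseteq> block_space blk j" "\<And>j. Xs j \<noteq> {}" "\<And>j. closed (Xs j)" "\<And>j. convex (Xs j)"
    and X_bound: "\<And>z. z \<in> block_prod blk Xs \<Longrightarrow> norm z \<le> M"
    and F_continuous: "continuous_on (block_prod blk Xs) F"
    and F_bound: "\<And>z. z \<in> block_prod blk Xs \<Longrightarrow> norm (F z) \<le> CF"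
    and sg_bound: "\<And>z. z \<in> block_prod blk Xs \<Longrightarrow> norm (sg z) \<le> Cf"
    and pmin: "0 < pmin" "\<And>j. pmin \<le> p j"
    and p_sum: "(\<Sum>j\<in>UNIV. p j) = 1"
    and \<gamma>_pos: "\<And>k. 0 < \<gamma> k"
    and \<eta>_nonneg: "\<And>k. 0 \<le> \<eta> k"
    and x0_measurable: "x0 \<in> borel_measurable P"
    and x0_in: "\<And>\<omega>. \<omega> \<in> space P \<Longrightarrow> x0 \<omega> \<in> block_prod blk Xs"
    and i_indep: "indep_vars (\<lambda>_. count_space UNIV) i UNIV"
    and i_distr: "\<And>k j. prob {\<omega> \<in> space P. i k \<omega> = j} = p j"
    and x0_indep: "indep_of P borel x0 (\<Pi>\<^sub>M k\<in>UNIV. count_space UNIV) (\<lambda>\<omega> k. i k \<omega>)"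
    and x_eq: "\<And>\<omega>. x \<omega> = arb_irg_iter blk Xs F sg \<gamma> \<eta> (x0 \<omega>) (\<lambda>k. i k \<omega>)"
    and sg_measurable: "\<And>k. (\<lambda>\<omega>. sg (x \<omega> k)) \<in> borel_measurable (history P x0 i k)"
begin

abbreviation X where "X \<equiv> block_prod blk Xs"

abbreviation H where "H \<equiv> history P x0 i"

definition G where "G k \<omega> = F (x \<omega> k) + \<eta> k *\<^sub>R sg (x \<omega> k)"

text \<open>Block \<open>j\<close> is drawn with probability \<open>p j\<close>, so dividing it by
  \<open>p j\<close> estimates \<open>G\<close> without bias. This is the part of \<open>G\<close>
  that the estimate misses, of mean zero under \<open>p\<close>.\<close>

definition noise where "noise j k \<omega> = G k \<omega> - (1 / p j) *\<^sub>R block blk j (G k \<omega>)"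

text \<open>
  The supremum in the gap function makes the comparison point depend on the sample path, so that
  the inner product of the noise with it has no zero mean. The projected path \<open>u\<close>, driven by the
  noise itself, absorbs this dependence.
\<close>

primrec u :: "nat \<Rightarrow> 'w \<Rightarrow> real ^ 'n" where
  "u 0 \<omega> = x0 \<omega>"
| "u (Suc k) \<omega> = closest_point X (u k \<omega> - \<gamma> k *\<^sub>R noise (i k \<omega>) k \<omega>)"

text \<open>All that one step leaves over besides the change of the potential. The two quadratic
  terms come from the projections defining \<open>x\<close> and \<open>u\<close>; the comparison
  point \<open>y\<close> does not occur.\<close>

definition err where
  "err j k \<omega> = noise j k \<omega> \<bullet> (x \<omega> k - u k \<omega>)
    + \<gamma> k / 2 * ((norm (block blk j (G k \<omega>)))\<^sup>2 / p j + (norm (noise j k \<omega>))\<^sup>2)"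

text \<open>An update of block \<open>j\<close> sees only block \<open>j\<close> of
  \<open>G\<close>; the weight \<open>1 / p j\<close> turns the resulting inner product into one
  with the unbiased estimate of all of \<open>G\<close>.\<close>

definition wdist2 :: "real ^ 'n \<Rightarrow> real" where
  "wdist2 v = (\<Sum>j\<in>UNIV. (norm (block blk j v))\<^sup>2 / p j)"

section \<open>Feasibility of the iterates\<close>

lemma X_closed: "closed X" and X_convex: "convex X"
  using Xs by (blast intro!: closed_block_prod convex_block_prod)+

lemma X_nonempty: "X \<noteq> {}"
  using Xs(1,2) by (rule block_prod_nonempty)

lemma p_pos: "0 < p j"
  using pmin[of] less_le_trans by blast

lemma pmin_le_1: "pmin \<le> 1"
proof -
  have "pmin \<le> p j" for j by (rule pmin)
  moreover have "p j \<le> (\<Sum>j\<in>UNIV. p j)" for j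
    using p_pos by (intro member_le_sum) (auto intro: less_imp_le)
  ultimately show ?thesis using p_sum order_trans by metis
qed

lemma x_0: "x \<omega> 0 = x0 \<omega>"
  by (simp add: x_eq)

text \<open>Defined for every candidate block rather than for the drawn one: with \<open>j\<close>
  fixed it depends on the history only.\<close>

definition proj :: "'d \<Rightarrow> nat \<Rightarrow> 'w \<Rightarrow> real ^ 'n" where
  "proj j k \<omega> = closest_point (Xs j) (block blk j (x \<omega> k) - \<gamma> k *\<^sub>R block blk j (G k \<omega>))"

lemma proj_in: "proj j k \<omega> \<in> Xs j"
  unfolding proj_def using Xs by (intro closest_point_in_set) auto

lemma x_Suc: "x \<omega> (Suc k) = x \<omega> k - block blk (i k \<omega>) (x \<omega> k) + proj (i k \<omega>) k \<omega>"
proof -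
  have "proj (i k \<omega>) k \<omega> $ l = 0" if "blk l \<noteq> i k \<omega>" for l
    using proj_in[of "i k \<omega>" k \<omega>] Xs(1)[of "i k \<omega>"] that by (auto simp: block_space_def)
  then show ?thesis
    by (auto simp: x_eq vec_eq_iff block_nth Let_def proj_def G_def block_add block_scaleR)
qed

lemma block_x_Suc: "block blk j (x \<omega> (Suc k)) = (if j = i k \<omega> then proj j k \<omega> else block blk j (x \<omega> k))"
proof -
  have proj: "block blk l (proj l k \<omega>) = proj l k \<omega>" for l
    unfolding block_eq_self_iff using proj_in Xs(1) by blast
  then have "block blk j (proj l k \<omega>) = (if j = l then proj j k \<omega> else 0)" for l
    by (metis block_block)
  then show ?thesis
    by (simp add: x_Suc block_add block_diff block_block)
qed

lemma x_in: "\<omega> \<in> space P \<Longrightarrow> x \<omega> k \<in> X"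
proof (induction k)
  case (Suc k)
  then show ?case
    by (auto simp: block_prod_def block_x_Suc proj_in)
qed (simp add: x_0 x0_in)

lemma u_in: "\<omega> \<in> space P \<Longrightarrow> u k \<omega> \<in> X"
  by (induction k) (auto simp: x0_in intro!: closest_point_in_set X_closed X_nonempty)

lemma X_dist_bound: "y \<in> X \<Longrightarrow> z \<in> X \<Longrightarrow> norm (y - z) \<le> 2 * M"
  using norm_triangle_ineq4[of y z] X_bound[of y] X_bound[of z] by linarith

section \<open>Pathwise inequalities and the weighted regret\<close>

lemma wdist2_step:
  assumes "y \<in> X"
  shows "wdist2 (x \<omega> (Suc k) - y)
    \<le> wdist2 (x \<omega> k - y) - 2 * \<gamma> k * ((G k \<omega> - noise (i k \<omega>) k \<omega>) \<bullet> (x \<omega> k - y))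
      + (\<gamma> k)\<^sup>2 * (norm (block blk (i k \<omega>) (G k \<omega>)))\<^sup>2 / p (i k \<omega>)"
proof -
  let ?j = "i k \<omega>"
  let ?b = "block blk ?j"
  let ?g = "?b (G k \<omega>)"
  let ?d = "?b (x \<omega> k) - ?b y"
  have "norm (proj ?j k \<omega> - ?b y) \<le> norm (?d - \<gamma> k *\<^sub>R ?g)"
    using norm_closest_point_diff_le[OF Xs(4,3), of "?b y" ?j "?b (x \<omega> k) - \<gamma> k *\<^sub>R ?g"] assms
    by (simp add: proj_def block_prod_def diff_diff_eq add.commute)
  then have "(norm (proj ?j k \<omega> - ?b y))\<^sup>2 \<le> (norm (?d - \<gamma> k *\<^sub>R ?g))\<^sup>2"
    by (rule power_mono) simp
  also have "\<dots> = (norm ?d)\<^sup>2 - 2 * \<gamma> k * (?g \<bullet> ?d) + (\<gamma> k)\<^sup>2 * (norm ?g)\<^sup>2"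
    by (rule norm_diff_scaleR_power2)
  also have "?g \<bullet> ?d = ?g \<bullet> (x \<omega> k - y)"
    by (simp add: inner_block_left[of _ _ _ "x \<omega> k - y"] block_diff)
  finally have "(norm (proj ?j k \<omega> - ?b y))\<^sup>2 / p ?j
      \<le> ((norm ?d)\<^sup>2 - 2 * \<gamma> k * (?g \<bullet> (x \<omega> k - y)) + (\<gamma> k)\<^sup>2 * (norm ?g)\<^sup>2) / p ?j"
    using p_pos by (intro divide_right_mono) (auto intro: less_imp_le)
  also have "\<dots> = (norm ?d)\<^sup>2 / p ?j - 2 * \<gamma> k * ((G k \<omega> - noise ?j k \<omega>) \<bullet> (x \<omega> k - y))
      + (\<gamma> k)\<^sup>2 * (norm ?g)\<^sup>2 / p ?j"
    by (simp add: noise_def diff_divide_distrib add_divide_distrib)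
  finally have j: "(norm (proj ?j k \<omega> - ?b y))\<^sup>2 / p ?j
      \<le> (norm ?d)\<^sup>2 / p ?j - 2 * \<gamma> k * ((G k \<omega> - noise ?j k \<omega>) \<bullet> (x \<omega> k - y))
      + (\<gamma> k)\<^sup>2 * (norm ?g)\<^sup>2 / p ?j" .
  \<comment> \<open>Only the drawn block moves, so the remaining summands agree before and after the
    step.\<close>
  have "wdist2 v = (norm (?b v))\<^sup>2 / p ?j + (\<Sum>j\<in>UNIV - {?j}. (norm (block blk j v))\<^sup>2 / p j)" for v
    unfolding wdist2_def by (rule sum.remove) auto
  then show ?thesis
    using j by (simp add: block_diff block_x_Suc)
qed

lemma u_step:
  assumes "y \<in> X"
  shows "(norm (u (Suc k) \<omega> - y))\<^sup>2
    \<le> (norm (u k \<omega> - y))\<^sup>2 - 2 * \<gamma> k * (noise (i k \<omega>) k \<omega> \<bullet> (u k \<omega> - y))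
      + (\<gamma> k)\<^sup>2 * (norm (noise (i k \<omega>) k \<omega>))\<^sup>2"
proof -
  let ?n = "noise (i k \<omega>) k \<omega>"
  have "norm (u (Suc k) \<omega> - y) \<le> norm ((u k \<omega> - y) - \<gamma> k *\<^sub>R ?n)"
    using norm_closest_point_diff_le[OF X_convex X_closed assms, of "u k \<omega> - \<gamma> k *\<^sub>R ?n"]
    by (simp add: algebra_simps)
  then have "(norm (u (Suc k) \<omega> - y))\<^sup>2 \<le> (norm ((u k \<omega> - y) - \<gamma> k *\<^sub>R ?n))\<^sup>2"
    by (rule power_mono) simp
  also have "\<dots> = (norm (u k \<omega> - y))\<^sup>2 - 2 * \<gamma> k * (?n \<bullet> (u k \<omega> - y)) + (\<gamma> k)\<^sup>2 * (norm ?n)\<^sup>2"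
    by (rule norm_diff_scaleR_power2)
  finally show ?thesis .
qed

text \<open>When the two projection steps are added, the noise meets \<open>x k - y\<close> with one
  sign and \<open>u k - y\<close> with the other. The difference is its inner product with
  \<open>x k - u k\<close>: the point \<open>y\<close> cancels, which makes the error uniform in
  \<open>y\<close>.\<close>

lemma potential_step:
  assumes "y \<in> X"
  shows "2 * \<gamma> k * (G k \<omega> \<bullet> (x \<omega> k - y))
    \<le> (wdist2 (x \<omega> k - y) + (norm (u k \<omega> - y))\<^sup>2)
      - (wdist2 (x \<omega> (Suc k) - y) + (norm (u (Suc k) \<omega> - y))\<^sup>2) + 2 * \<gamma> k * err (i k \<omega>) k \<omega>"
proof -
  have "2 * \<gamma> k * err (i k \<omega>) k \<omega>
      = 2 * \<gamma> k * (noise (i k \<omega>) k \<omega> \<bullet> (x \<omega> k - y)) - 2 * \<gamma> k * (noise (i k \<omega>) k \<omega> \<bullet> (u k \<omega> - y))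
        + (\<gamma> k)\<^sup>2 * (norm (block blk (i k \<omega>) (G k \<omega>)))\<^sup>2 / p (i k \<omega>) + (\<gamma> k)\<^sup>2 * (norm (noise (i k \<omega>) k \<omega>))\<^sup>2"
    by (simp add: err_def inner_diff_right algebra_simps power2_eq_square)
  then show ?thesis
    using wdist2_step[OF assms, of \<omega> k] u_step[OF assms, of k \<omega>]
    by (simp add: inner_diff_left algebra_simps)
qed

lemma wdist2_nonneg: "0 \<le> wdist2 v"
  unfolding wdist2_def using p_pos by (intro sum_nonneg divide_nonneg_pos) auto

lemma wdist2_le: "wdist2 v \<le> (norm v)\<^sup>2 / pmin"
proof -
  have "wdist2 v \<le> (\<Sum>j\<in>UNIV. (norm (block blk j v))\<^sup>2 / pmin)"
    unfolding wdist2_def using pmin p_pos by (intro sum_mono divide_left_mono) auto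
  then show ?thesis
    by (simp add: sum_norm_block flip: sum_divide_distrib)
qed

text \<open>Two squared diameters \<open>(2 * M)^2\<close>, one for each path. The unweighted one is
  enlarged by the factor \<open>1 / pmin\<close>, at least 1, to share the constant.\<close>

lemma potential_bound:
  assumes "\<omega> \<in> space P" "y \<in> X"
  shows "wdist2 (x \<omega> k - y) + (norm (u k \<omega> - y))\<^sup>2 \<le> 8 * M\<^sup>2 / pmin"
proof -
  have "(norm (x \<omega> k - y))\<^sup>2 \<le> (2 * M)\<^sup>2" "(norm (u k \<omega> - y))\<^sup>2 \<le> (2 * M)\<^sup>2"
    by (intro power_mono X_dist_bound x_in u_in assms norm_ge_zero)+
  moreover from this have "wdist2 (x \<omega> k - y) \<le> (2 * M)\<^sup>2 / pmin"
    using wdist2_le[of "x \<omega> k - y"] pmin(1) by (meson divide_right_mono less_imp_le order_trans)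
  moreover have "(2 * M)\<^sup>2 \<le> (2 * M)\<^sup>2 / pmin"
    using pmin(1) pmin_le_1 by (simp add: pos_le_divide_eq mult_left_le)
  ultimately show ?thesis by (simp add: power_mult_distrib)
qed

text \<open>Scaling \<open>potential_step\<close> by \<open>a k / (2 * \<gamma> k)\<close> puts
  nondecreasing coefficients before the potential differences, so Abel summation charges only the
  last one. The 2 in the denominator turns \<open>8 * M^2\<close> into the constant
  \<open>4 * M^2\<close> of the theorem.\<close>

lemma weighted_regret_le:
  assumes \<omega>: "\<omega> \<in> space P" and y: "y \<in> X"
    and a: "\<And>k. 0 \<le> a k" "mono (\<lambda>k. a k / \<gamma> k)"
  shows "(\<Sum>k\<le>N. a k * (G k \<omega> \<bullet> (x \<omega> k - y)))
    \<le> a N / \<gamma> N * (4 * M\<^sup>2 / pmin) + (\<Sum>k\<le>N. a k * err (i k \<omega>) k \<omega>)"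
proof -
  define E where "E k = wdist2 (x \<omega> k - y) + (norm (u k \<omega> - y))\<^sup>2" for k
  have "a k * (G k \<omega> \<bullet> (x \<omega> k - y)) \<le> a k / \<gamma> k / 2 * (E k - E (Suc k)) + a k * err (i k \<omega>) k \<omega>" for k
  proof -
    have "a k / \<gamma> k / 2 * (2 * \<gamma> k * (G k \<omega> \<bullet> (x \<omega> k - y)))
        \<le> a k / \<gamma> k / 2 * (E k - E (Suc k) + 2 * \<gamma> k * err (i k \<omega>) k \<omega>)"
      unfolding E_def using potential_step[OF y, of k \<omega>] a(1)[of k] \<gamma>_pos[of k]
      by (intro mult_left_mono) auto
    then show ?thesis
      using \<gamma>_pos[of k] by (simp add: distrib_left)
  qed
  then have "(\<Sum>k\<le>N. a k * (G k \<omega> \<bullet> (x \<omega> k - y)))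
      \<le> (\<Sum>k\<le>N. a k / \<gamma> k / 2 * (E k - E (Suc k))) + (\<Sum>k\<le>N. a k * err (i k \<omega>) k \<omega>)"
    unfolding sum.distrib[symmetric] by (rule sum_mono)
  also have "(\<Sum>k\<le>N. a k / \<gamma> k / 2 * (E k - E (Suc k))) \<le> a N / \<gamma> N / 2 * (8 * M\<^sup>2 / pmin)"
  proof (rule sum_telescope_weighted_le)
    show "mono (\<lambda>k. a k / \<gamma> k / 2)"
      by (intro monoI divide_right_mono monoD[OF a(2)]) auto
    show "0 \<le> a 0 / \<gamma> 0 / 2"
      using a(1)[of 0] \<gamma>_pos[of 0] by simp
  qed (use potential_bound[OF \<omega> y] in \<open>auto simp: E_def wdist2_nonneg\<close>)
  finally show ?thesis by (simp add: mult.left_commute)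
qed

section \<open>Bounds on the error averaged over the block\<close>

lemma G_bound:
  assumes "\<omega> \<in> space P"
  shows "norm (G k \<omega>) \<le> CF + \<eta> k * Cf"
proof -
  have "norm (G k \<omega>) \<le> norm (F (x \<omega> k)) + \<eta> k * norm (sg (x \<omega> k))"
    unfolding G_def using norm_triangle_ineq[of "F (x \<omega> k)" "\<eta> k *\<^sub>R sg (x \<omega> k)"] \<eta>_nonneg[of k] by simp
  also have "\<dots> \<le> CF + \<eta> k * Cf"
    using F_bound[OF x_in[OF assms]] sg_bound[OF x_in[OF assms]] \<eta>_nonneg[of k]
    by (intro add_mono mult_left_mono) auto
  finally show ?thesis .
qed

lemma G_norm2_bound:
  assumes "\<omega> \<in> space P"
  shows "(norm (G k \<omega>))\<^sup>2 \<le> 2 * (CF\<^sup>2 + (\<eta> k)\<^sup>2 * Cf\<^sup>2)"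
proof -
  have "(norm (G k \<omega>))\<^sup>2 \<le> (CF + \<eta> k * Cf)\<^sup>2"
    using G_bound[OF assms] by (rule power_mono) simp
  also have "\<dots> \<le> 2 * (CF\<^sup>2 + (\<eta> k)\<^sup>2 * Cf\<^sup>2)"
    using sum_power2_le[of CF "\<eta> k * Cf"] by (simp add: power_mult_distrib)
  finally show ?thesis .
qed

lemma sum_p_noise: "(\<Sum>j\<in>UNIV. p j *\<^sub>R noise j k \<omega>) = 0"
proof -
  have "p j *\<^sub>R noise j k \<omega> = p j *\<^sub>R G k \<omega> - block blk j (G k \<omega>)" for j
    using p_pos[of j] by (simp add: noise_def scaleR_diff_right)
  then show ?thesis
    by (simp add: sum_subtractf sum_block p_sum flip: scaleR_sum_left)
qed

text \<open>The sum equals \<open>wdist2 (G k \<omega>)\<close> exactly: the projection for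
  \<open>x\<close> contributes the squared norm of \<open>G\<close>, and the variance of the
  estimate is \<open>wdist2\<close> minus that same squared norm. The auxiliary path thus costs no
  extra constant here.\<close>

lemma sum_p_noise_norm2:
  "(\<Sum>j\<in>UNIV. p j * ((norm (block blk j (G k \<omega>)))\<^sup>2 / p j + (norm (noise j k \<omega>))\<^sup>2))
    \<le> (norm (G k \<omega>))\<^sup>2 / pmin"
proof -
  let ?g = "G k \<omega>"
  have "p j * ((norm (block blk j ?g))\<^sup>2 / p j + (norm (noise j k \<omega>))\<^sup>2)
      = p j * (norm ?g)\<^sup>2 - (norm (block blk j ?g))\<^sup>2 + (norm (block blk j ?g))\<^sup>2 / p j" for j
  proof -
    have "block blk j ?g \<bullet> ?g = (norm (block blk j ?g))\<^sup>2"
      by (simp add: power2_norm_eq_inner inner_block_left[of _ _ _ ?g])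
    then have "(norm (noise j k \<omega>))\<^sup>2 = (norm ?g)\<^sup>2 - 2 / p j * (norm (block blk j ?g))\<^sup>2
        + (norm (block blk j ?g))\<^sup>2 / (p j)\<^sup>2"
      unfolding noise_def norm_diff_scaleR_power2 by (simp add: power_divide)
    then show ?thesis
      using p_pos[of j] by (simp add: field_simps power2_eq_square)
  qed
  then have "(\<Sum>j\<in>UNIV. p j * ((norm (block blk j ?g))\<^sup>2 / p j + (norm (noise j k \<omega>))\<^sup>2)) = wdist2 ?g"
    by (simp add: sum.distrib sum_subtractf sum_norm_block p_sum wdist2_def flip: sum_distrib_right)
  then show ?thesis
    using wdist2_le by simp
qed

text \<open>The vector \<open>x - u\<close> is the same for all candidate blocks, so unbiasedness
  removes the linear term. The factor 2 in the bound on the squared norm of \<open>G\<close> cancels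
  the \<open>1 / 2\<close> in \<open>err\<close>.\<close>

lemma sum_p_err_le:
  assumes "\<omega> \<in> space P"
  shows "(\<Sum>j\<in>UNIV. p j * err j k \<omega>) \<le> \<gamma> k * (CF\<^sup>2 + (\<eta> k)\<^sup>2 * Cf\<^sup>2) / pmin"
proof -
  have "(\<Sum>j\<in>UNIV. p j * err j k \<omega>) = (\<Sum>j\<in>UNIV. p j *\<^sub>R noise j k \<omega>) \<bullet> (x \<omega> k - u k \<omega>)
      + \<gamma> k / 2 * (\<Sum>j\<in>UNIV. p j * ((norm (block blk j (G k \<omega>)))\<^sup>2 / p j + (norm (noise j k \<omega>))\<^sup>2))"
    unfolding err_def inner_sum_left sum_distrib_left sum.distrib[symmetric]
    by (intro sum.cong refl) (simp only: inner_scaleR_left algebra_simps)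
  also have "\<dots> \<le> \<gamma> k / 2 * ((norm (G k \<omega>))\<^sup>2 / pmin)"
    unfolding sum_p_noise inner_zero_left add_0 using sum_p_noise_norm2[of k \<omega>] \<gamma>_pos[of k]
    by (intro mult_left_mono) auto
  also have "\<dots> \<le> \<gamma> k / 2 * (2 * (CF\<^sup>2 + (\<eta> k)\<^sup>2 * Cf\<^sup>2) / pmin)"
    using G_norm2_bound[OF assms, of k] \<gamma>_pos[of k] pmin(1)
    by (intro mult_left_mono divide_right_mono) auto
  also have "\<dots> = \<gamma> k * (CF\<^sup>2 + (\<eta> k)\<^sup>2 * Cf\<^sup>2) / pmin"
    using pmin(1) by (simp add: field_simps)
  finally show ?thesis .
qed

section \<open>Measurability along the history, integrability\<close>

lemma G_measurable_if:
  assumes "(\<lambda>\<omega>. x \<omega> k) \<in> borel_measurable (H k)"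
  shows "G k \<in> borel_measurable (H k)"
proof -
  \<comment> \<open>Continuity of \<open>F\<close> is given on \<open>X\<close> only, hence the
    detour through the subspace. The premise on \<open>x\<close> avoids a circle:
    \<open>x_measurable\<close> uses this lemma in its induction step.\<close>
  have "(\<lambda>\<omega>. x \<omega> k) \<in> H k \<rightarrow>\<^sub>M restrict_space borel X"
    using assms x_in by (intro measurable_restrict_space2) auto
  from measurable_compose[OF this borel_measurable_continuous_on_restrict[OF F_continuous]]
  show ?thesis
    unfolding G_def[abs_def] using sg_measurable[of k] by measurable
qed

lemma i_measurable: "i k \<in> H (Suc k) \<rightarrow>\<^sub>M count_space UNIV"
  by (rule index_measurable_history) simp

lemma x_measurable: "(\<lambda>\<omega>. x \<omega> k) \<in> borel_measurable (H k)"
proof (induction k)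
  case 0
  show ?case unfolding x_0 by (rule x0_measurable_history)
next
  case (Suc k)
  note [measurable] = Suc G_measurable_if[OF Suc]
  \<comment> \<open>Each candidate update is already measurable for \<open>H k\<close>; only
    inserting the drawn index requires \<open>H (Suc k)\<close>.\<close>
  have "(\<lambda>\<omega>. x \<omega> k - block blk j (x \<omega> k) + proj j k \<omega>) \<in> borel_measurable (H k)" for j
    unfolding proj_def using Xs
    by (intro borel_measurable_add borel_measurable_diff borel_measurable_scaleR
        closest_point_measurable block_measurable) auto
  then have "(\<lambda>\<omega>. x \<omega> k - block blk j (x \<omega> k) + proj j k \<omega>) \<in> borel_measurable (H (Suc k))" for j
    by (rule measurable_history_mono) simp
  from measurable_compose_countable[OF this i_measurable] show ?case
    unfolding x_Suc .
qed

lemmas G_measurable = G_measurable_if[OF x_measurable]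

lemma noise_measurable: "noise j k \<in> borel_measurable (H k)"
  unfolding noise_def[abs_def]
  by (intro borel_measurable_diff borel_measurable_scaleR block_measurable G_measurable) simp

lemma u_measurable: "u k \<in> borel_measurable (H k)"
proof (induction k)
  case 0
  show ?case using x0_measurable_history by simp
next
  case (Suc k)
  have "(\<lambda>\<omega>. closest_point X (u k \<omega> - \<gamma> k *\<^sub>R noise j k \<omega>)) \<in> borel_measurable (H k)" for j
    using Suc noise_measurable
    by (intro closest_point_measurable X_convex X_closed X_nonempty borel_measurable_diff
        borel_measurable_scaleR) auto
  then have "(\<lambda>\<omega>. closest_point X (u k \<omega> - \<gamma> k *\<^sub>R noise j k \<omega>)) \<in> borel_measurable (H (Suc k))" for j
    by (rule measurable_history_mono) simp
  from measurable_compose_countable[OF this i_measurable] show ?case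
    by simp
qed

lemma err_measurable: "err j k \<in> borel_measurable (H k)"
proof -
  note [measurable] = x_measurable u_measurable noise_measurable block_measurable[OF G_measurable]
  show ?thesis
    unfolding err_def[abs_def] by measurable
qed

lemma measurable_P_if_history:
  assumes "g \<in> H k \<rightarrow>\<^sub>M N"
  shows "g \<in> P \<rightarrow>\<^sub>M N"
proof -
  have "i l \<in> P \<rightarrow>\<^sub>M count_space UNIV" for l
    using i_indep by (auto simp: indep_vars_def)
  from measurable_compose[OF id_measurable_history[OF x0_measurable this] assms]
  show ?thesis .
qed

lemma err_integrable: "integrable P (err j k)"
proof (rule integrable_const_bound)
  \<comment> \<open>\<open>?K\<close> bounds \<open>G\<close> and each of its blocks,
    \<open>?L\<close> the noise.\<close>
  let ?K = "CF + \<eta> k * Cf"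
  let ?L = "?K + ?K / p j"
  have "norm (err j k \<omega>) \<le> ?L * (2 * M) + \<gamma> k / 2 * (?K\<^sup>2 / p j + ?L\<^sup>2)" if \<omega>: "\<omega> \<in> space P" for \<omega>
  proof -
    have b: "norm (block blk j (G k \<omega>)) \<le> ?K"
      using norm_block_le[of blk j "G k \<omega>"] G_bound[OF \<omega>, of k] by linarith
    have "norm (noise j k \<omega>) \<le> norm (G k \<omega>) + norm (block blk j (G k \<omega>)) / p j"
      unfolding noise_def using norm_triangle_ineq4[of "G k \<omega>" "(1 / p j) *\<^sub>R block blk j (G k \<omega>)"] p_pos[of j]
      by simp
    also have "\<dots> \<le> ?L"
      using b G_bound[OF \<omega>, of k] p_pos[of j] by (intro add_mono divide_right_mono) auto
    finally have n: "norm (noise j k \<omega>) \<le> ?L" .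
    have "\<bar>noise j k \<omega> \<bullet> (x \<omega> k - u k \<omega>)\<bar> \<le> norm (noise j k \<omega>) * norm (x \<omega> k - u k \<omega>)"
      by (rule Cauchy_Schwarz_ineq2)
    also have "\<dots> \<le> ?L * (2 * M)"
      using order_trans[OF norm_ge_zero n] by (intro mult_mono X_dist_bound x_in u_in \<omega> n) auto
    finally have 1: "\<bar>noise j k \<omega> \<bullet> (x \<omega> k - u k \<omega>)\<bar> \<le> ?L * (2 * M)" .
    let ?q = "\<gamma> k / 2 * ((norm (block blk j (G k \<omega>)))\<^sup>2 / p j + (norm (noise j k \<omega>))\<^sup>2)"
    have 2: "?q \<le> \<gamma> k / 2 * (?K\<^sup>2 / p j + ?L\<^sup>2)"
      using b n p_pos[of j] \<gamma>_pos[of k]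
      by (intro mult_left_mono add_mono divide_right_mono power_mono) auto
    have "0 \<le> ?q"
      using p_pos[of j] \<gamma>_pos[of k] by simp
    with 1 2 show ?thesis
      unfolding err_def real_norm_def by linarith
  qed
  then show "AE \<omega> in P. norm (err j k \<omega>) \<le> ?L * (2 * M) + \<gamma> k / 2 * (?K\<^sup>2 / p j + ?L\<^sup>2)"
    by simp
qed (rule measurable_P_if_history[OF err_measurable])

lemma err_index_integrable: "integrable P (\<lambda>\<omega>. err (i k \<omega>) k \<omega>)"
  by (rule expectation_at_index(1)[OF x0_measurable i_indep x0_indep err_measurable err_integrable])

lemma expectation_err_le:
  "expectation (\<lambda>\<omega>. err (i k \<omega>) k \<omega>) \<le> \<gamma> k * (CF\<^sup>2 + (\<eta> k)\<^sup>2 * Cf\<^sup>2) / pmin"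
proof -
  have "expectation (\<lambda>\<omega>. err (i k \<omega>) k \<omega>) = expectation (\<lambda>\<omega>. \<Sum>j\<in>UNIV. p j * err j k \<omega>)"
    using expectation_at_index(2)[OF x0_measurable i_indep x0_indep err_measurable err_integrable]
    by (simp add: i_distr)
  also have "\<dots> \<le> expectation (\<lambda>\<omega>. \<gamma> k * (CF\<^sup>2 + (\<eta> k)\<^sup>2 * Cf\<^sup>2) / pmin)"
    by (intro integral_mono sum_p_err_le Bochner_Integration.integrable_sum integrable_mult_right
        err_integrable) auto
  finally show ?thesis by (simp add: prob_space)
qed

lemma sum_err_integrable: "integrable P (\<lambda>\<omega>. \<Sum>k\<le>N. a k * err (i k \<omega>) k \<omega>)"
  by (intro Bochner_Integration.integrable_sum integrable_mult_right err_index_integrable)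

lemma expectation_sum_err_le:
  assumes "\<And>k. 0 \<le> a k"
  shows "expectation (\<lambda>\<omega>. \<Sum>k\<le>N. a k * err (i k \<omega>) k \<omega>)
    \<le> (\<Sum>k\<le>N. a k * \<gamma> k * (CF\<^sup>2 + (\<eta> k)\<^sup>2 * Cf\<^sup>2)) / pmin"
proof -
  have "expectation (\<lambda>\<omega>. \<Sum>k\<le>N. a k * err (i k \<omega>) k \<omega>) = (\<Sum>k\<le>N. a k * expectation (\<lambda>\<omega>. err (i k \<omega>) k \<omega>))"
    by (subst Bochner_Integration.integral_sum) (auto intro: err_index_integrable)
  also have "\<dots> \<le> (\<Sum>k\<le>N. a k * (\<gamma> k * (CF\<^sup>2 + (\<eta> k)\<^sup>2 * Cf\<^sup>2) / pmin))"
    using assms by (intro sum_mono mult_left_mono expectation_err_le) auto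
  finally show ?thesis
    by (simp add: sum_divide_distrib mult.assoc)
qed

section \<open>Expected objective and expected gap\<close>

lemma xbar_in: "\<omega> \<in> space P \<Longrightarrow> weighted_avg \<gamma> r (x \<omega>) N \<in> X"
  by (intro weighted_avg_in_convex \<gamma>_pos X_convex x_in)

lemma expectation_fun_le:
  assumes f: "convex_on UNIV f" and sg: "\<And>z. sg z \<in> subdifferential f z"
    and F: "monotone_map_on X F" and xs: "xs \<in> SOL X F"
    and \<eta>: "\<And>k. 0 < \<eta> k" and mono: "mono (\<lambda>k. \<gamma> k powr r / \<eta> k / \<gamma> k)"
  shows "avg_weight \<gamma> r N * ((\<integral>\<omega>. f (weighted_avg \<gamma> r (x \<omega>) N) \<partial>P) - f xs)
    \<le> \<gamma> N powr r / \<eta> N / \<gamma> N * (4 * M\<^sup>2 / pmin)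
      + (\<Sum>k\<le>N. \<gamma> k powr r / \<eta> k * \<gamma> k * (CF\<^sup>2 + (\<eta> k)\<^sup>2 * Cf\<^sup>2)) / pmin"
proof -
  define S where "S = avg_weight \<gamma> r N"
  have S: "0 < S"
    unfolding S_def by (rule avg_weight_pos) (rule \<gamma>_pos)
  define a where "a k = \<gamma> k powr r / \<eta> k" for k
  have a: "0 \<le> a k" for k
    using \<eta>[of k] by (simp add: a_def)
  define B where "B = a N / \<gamma> N * (4 * M\<^sup>2 / pmin)"
  define R where "R \<omega> = B + (\<Sum>k\<le>N. a k * err (i k \<omega>) k \<omega>)" for \<omega>
  have xs_X: "xs \<in> X"
    using xs by (simp add: SOL_def)
  have path: "S * (f (weighted_avg \<gamma> r (x \<omega>) N) - f xs) \<le> R \<omega>" if \<omega>: "\<omega> \<in> space P" for \<omega>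
  proof -
    have "S * (f (weighted_avg \<gamma> r (x \<omega>) N) - f xs) \<le> (\<Sum>k\<le>N. \<gamma> k powr r * (f (x \<omega> k) - f xs))"
      using convex_on_weighted_avg_le[of \<gamma> f r N "x \<omega>", OF \<gamma>_pos f]
      by (simp add: S_def avg_weight_eq_sum right_diff_distrib sum_subtractf sum_distrib_right)
    also have "\<dots> \<le> (\<Sum>k\<le>N. a k * (G k \<omega> \<bullet> (x \<omega> k - xs)))"
    proof (rule sum_mono)
      fix k
      have "f (x \<omega> k) - f xs \<le> sg (x \<omega> k) \<bullet> (x \<omega> k - xs)"
      proof -
        have "f (x \<omega> k) + sg (x \<omega> k) \<bullet> (xs - x \<omega> k) \<le> f xs"
          using sg[of "x \<omega> k"] by (simp add: subdifferential_def)
        then show ?thesis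
          by (simp add: inner_diff_right)
      qed
      then have "\<gamma> k powr r * (f (x \<omega> k) - f xs) \<le> \<gamma> k powr r * (sg (x \<omega> k) \<bullet> (x \<omega> k - xs))"
        by (rule mult_left_mono) simp
      \<comment> \<open>Dividing by \<open>\<eta> k\<close> undoes the factor of the subgradient
        inside \<open>G\<close>, so the objective values keep the weights of the average.\<close>
      also have "\<dots> = a k * (\<eta> k * (sg (x \<omega> k) \<bullet> (x \<omega> k - xs)))"
        using \<eta>[of k] by (simp add: a_def)
      also have "\<dots> \<le> a k * (G k \<omega> \<bullet> (x \<omega> k - xs))"
      proof (rule mult_left_mono[OF _ a])
        \<comment> \<open>Monotonicity moves the variational inequality from \<open>xs\<close> to
          the iterate: the inner product of \<open>F (x \<omega> k)\<close> with
          \<open>x \<omega> k - xs\<close> is nonnegative, so the \<open>F\<close> part of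
          \<open>G\<close> may be added for free.\<close>
        have "0 \<le> F xs \<bullet> (x \<omega> k - xs)"
          using xs x_in[OF \<omega>] by (simp add: SOL_def)
        moreover have "0 \<le> (F (x \<omega> k) - F xs) \<bullet> (x \<omega> k - xs)"
          using F x_in[OF \<omega>] xs_X by (simp add: monotone_map_on_def)
        ultimately show "\<eta> k * (sg (x \<omega> k) \<bullet> (x \<omega> k - xs)) \<le> G k \<omega> \<bullet> (x \<omega> k - xs)"
          by (simp add: G_def inner_add_left inner_diff_left)
      qed
      finally show "\<gamma> k powr r * (f (x \<omega> k) - f xs) \<le> a k * (G k \<omega> \<bullet> (x \<omega> k - xs))" .
    qed
    also have "\<dots> \<le> R \<omega>"
      unfolding R_def B_def using a mono
      by (intro weighted_regret_le[OF \<omega> xs_X]) (auto simp: a_def)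
    finally show ?thesis .
  qed
  have f_cont: "continuous_on UNIV f"
    using f by (intro convex_on_continuous) auto
  have "compact X"
    using X_bound X_closed by (auto simp: compact_eq_bounded_closed intro: boundedI)
  then have "bounded (f ` X)"
    using f_cont by (intro compact_imp_bounded compact_continuous_image) (auto intro: continuous_on_subset)
  then obtain K where K: "\<And>z. z \<in> X \<Longrightarrow> norm (f z) \<le> K"
    by (auto simp: bounded_iff)
  have f_int: "integrable P (\<lambda>\<omega>. f (weighted_avg \<gamma> r (x \<omega>) N))"
  proof (rule integrable_const_bound)
    have "(\<lambda>\<omega>. weighted_avg \<gamma> r (x \<omega>) N) \<in> borel_measurable P"
      unfolding weighted_avg_eq_sum[of \<gamma>, OF \<gamma>_pos]
      by (intro borel_measurable_sum borel_measurable_scaleR measurable_P_if_history[OF x_measurable]) auto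
    then show "(\<lambda>\<omega>. f (weighted_avg \<gamma> r (x \<omega>) N)) \<in> borel_measurable P"
      by (rule measurable_compose) (rule borel_measurable_continuous_onI[OF f_cont])
    show "AE \<omega> in P. norm (f (weighted_avg \<gamma> r (x \<omega>) N)) \<le> K"
      using K xbar_in by (intro AE_I2) auto
  qed
  have R_int: "integrable P R"
    unfolding R_def[abs_def] by (intro Bochner_Integration.integrable_add sum_err_integrable) simp
  have "S * (expectation (\<lambda>\<omega>. f (weighted_avg \<gamma> r (x \<omega>) N)) - f xs)
      = expectation (\<lambda>\<omega>. S * (f (weighted_avg \<gamma> r (x \<omega>) N) - f xs))"
    using f_int by (simp add: prob_space)
  also have "\<dots> \<le> expectation R"
    using f_int R_int path by (intro integral_mono) auto
  also have "\<dots> = B + expectation (\<lambda>\<omega>. \<Sum>k\<le>N. a k * err (i k \<omega>) k \<omega>)"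
    unfolding R_def[abs_def] by (subst Bochner_Integration.integral_add) (simp_all add: sum_err_integrable prob_space)
  also have "\<dots> \<le> B + (\<Sum>k\<le>N. a k * \<gamma> k * (CF\<^sup>2 + (\<eta> k)\<^sup>2 * Cf\<^sup>2)) / pmin"
    by (intro add_left_mono expectation_sum_err_le a)
  finally show ?thesis
    unfolding S_def B_def a_def .
qed

lemma expectation_GAP_le:
  assumes F: "monotone_map_on X F" and mono: "mono (\<lambda>k. \<gamma> k powr r / \<gamma> k)"
  shows "avg_weight \<gamma> r N * (\<integral>\<omega>. GAP X F (weighted_avg \<gamma> r (x \<omega>) N) \<partial>P)
    \<le> \<gamma> N powr r / \<gamma> N * (4 * M\<^sup>2 / pmin)
      + (\<Sum>k\<le>N. \<gamma> k powr r * \<gamma> k * (CF\<^sup>2 + (\<eta> k)\<^sup>2 * Cf\<^sup>2)) / pmin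
      + (\<Sum>k\<le>N. \<gamma> k powr r * \<eta> k) * (2 * Cf * M)"
proof -
  define S where "S = avg_weight \<gamma> r N"
  have S: "0 < S"
    unfolding S_def by (rule avg_weight_pos) (rule \<gamma>_pos)
  define B where "B = \<gamma> N powr r / \<gamma> N * (4 * M\<^sup>2 / pmin) + (\<Sum>k\<le>N. \<gamma> k powr r * \<eta> k) * (2 * Cf * M)"
  define R where "R \<omega> = B + (\<Sum>k\<le>N. \<gamma> k powr r * err (i k \<omega>) k \<omega>)" for \<omega>
  \<comment> \<open>\<open>R\<close> does not mention \<open>y\<close>, so the supremum is taken on
    each path before the expectation.\<close>
  have path: "F y \<bullet> (weighted_avg \<gamma> r (x \<omega>) N - y) \<le> R \<omega> / S" if \<omega>: "\<omega> \<in> space P" and y: "y \<in> X" for \<omega> y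
  proof -
    have "S * (F y \<bullet> (weighted_avg \<gamma> r (x \<omega>) N - y))
        = F y \<bullet> (S *\<^sub>R weighted_avg \<gamma> r (x \<omega>) N - S *\<^sub>R y)"
      by (simp add: inner_diff_right right_diff_distrib)
    also have "\<dots> = (\<Sum>k\<le>N. \<gamma> k powr r * (F y \<bullet> (x \<omega> k - y)))"
      unfolding S_def scaleR_weighted_avg[of \<gamma>, OF \<gamma>_pos] unfolding avg_weight_eq_sum
      by (simp add: scaleR_sum_left inner_diff_right inner_sum_right right_diff_distrib sum_subtractf)
    also have "\<dots> \<le> (\<Sum>k\<le>N. \<gamma> k powr r * (G k \<omega> \<bullet> (x \<omega> k - y)) + \<gamma> k powr r * \<eta> k * (2 * Cf * M))"
    proof (rule sum_mono)
      fix k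
      \<comment> \<open>Here \<open>y\<close> need not favour the objective, so the subgradient part
        of \<open>G\<close> has no useful sign. It is paid for with the bound on \<open>sg\<close>
        and the diameter \<open>2 * M\<close>, which produces the third term of the gap
        bound.\<close>
      have "\<bar>sg (x \<omega> k) \<bullet> (x \<omega> k - y)\<bar> \<le> norm (sg (x \<omega> k)) * norm (x \<omega> k - y)"
        by (rule Cauchy_Schwarz_ineq2)
      also have "\<dots> \<le> Cf * (2 * M)"
        using order_trans[OF norm_ge_zero sg_bound[OF x_in[OF \<omega>]]]
        by (intro mult_mono sg_bound X_dist_bound x_in \<omega> y) auto
      finally have "\<eta> k * - (sg (x \<omega> k) \<bullet> (x \<omega> k - y)) \<le> \<eta> k * (Cf * (2 * M))"
        using \<eta>_nonneg[of k] by (intro mult_left_mono) auto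
      moreover have "0 \<le> (F (x \<omega> k) - F y) \<bullet> (x \<omega> k - y)"
        using F x_in[OF \<omega>] y by (simp add: monotone_map_on_def)
      ultimately have "F y \<bullet> (x \<omega> k - y) \<le> G k \<omega> \<bullet> (x \<omega> k - y) + \<eta> k * (2 * Cf * M)"
        by (simp add: G_def inner_add_left inner_diff_left)
      then have "\<gamma> k powr r * (F y \<bullet> (x \<omega> k - y)) \<le> \<gamma> k powr r * (G k \<omega> \<bullet> (x \<omega> k - y) + \<eta> k * (2 * Cf * M))"
        by (rule mult_left_mono) simp
      then show "\<gamma> k powr r * (F y \<bullet> (x \<omega> k - y))
          \<le> \<gamma> k powr r * (G k \<omega> \<bullet> (x \<omega> k - y)) + \<gamma> k powr r * \<eta> k * (2 * Cf * M)"
        by (simp add: distrib_left mult.assoc)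
    qed
    also have "\<dots> \<le> R \<omega>"
      using weighted_regret_le[OF \<omega> y, of "\<lambda>k. \<gamma> k powr r" N] mono
      by (simp add: R_def B_def sum.distrib sum_distrib_right)
    finally show ?thesis
      using S by (simp add: pos_le_divide_eq mult.commute)
  qed
  have R_int: "integrable P R"
    unfolding R_def[abs_def] by (intro Bochner_Integration.integrable_add sum_err_integrable) simp
  have "expectation (\<lambda>\<omega>. GAP X F (weighted_avg \<gamma> r (x \<omega>) N)) \<le> expectation (\<lambda>\<omega>. R \<omega> / S)"
    \<comment> \<open>The gap along the averages need not be shown integrable: the integral of a non-integrable
      function is 0, and the bound is nonnegative.\<close>
  proof (rule integral_mono')
    fix \<omega> assume \<omega>: "\<omega> \<in> space P"
    show "GAP X F (weighted_avg \<gamma> r (x \<omega>) N) \<le> R \<omega> / S"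
      unfolding GAP_def using path[OF \<omega>] by (intro cSUP_least X_nonempty)
    \<comment> \<open>Comparing the average with itself makes the left-hand side of
      \<open>path\<close> zero.\<close>
    show "0 \<le> R \<omega> / S"
      using path[OF \<omega> xbar_in[OF \<omega>, of r N]] by simp
  qed (use R_int in simp)
  then have "S * expectation (\<lambda>\<omega>. GAP X F (weighted_avg \<gamma> r (x \<omega>) N)) \<le> expectation R"
    using S by (simp add: pos_le_divide_eq mult.commute)
  also have "\<dots> = B + expectation (\<lambda>\<omega>. \<Sum>k\<le>N. \<gamma> k powr r * err (i k \<omega>) k \<omega>)"
    unfolding R_def[abs_def] by (subst Bochner_Integration.integral_add) (simp_all add: sum_err_integrable prob_space)
  also have "\<dots> \<le> B + (\<Sum>k\<le>N. \<gamma> k powr r * \<gamma> k * (CF\<^sup>2 + (\<eta> k)\<^sup>2 * Cf\<^sup>2)) / pmin"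
    by (intro add_left_mono expectation_sum_err_le) simp
  finally show ?thesis
    unfolding S_def B_def by simp
qed

end

subsection \<open>The power schedule\<close>

locale power_schedule =
  fixes \<gamma> \<eta> :: "nat \<Rightarrow> real" and \<gamma>0 \<eta>0 b r :: real
  assumes r: "0 \<le> r" "r < 1"
    and params: "0 < \<gamma>0" "0 < \<eta>0" "0 < b" "b < 1 / 2"
    and \<gamma>_eq: "\<And>k. \<gamma> k = \<gamma>0 / sqrt (real k + 1)"
    and \<eta>_eq: "\<And>k. \<eta> k = \<eta>0 / (real k + 1) powr b"
begin

lemma \<gamma>_pos: "0 < \<gamma> k" and \<eta>_pos: "0 < \<eta> k"
  using params by (auto simp: \<gamma>_eq \<eta>_eq)

lemma \<eta>_le: "\<eta> k \<le> \<eta>0"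
proof -
  have "1 \<le> (real k + 1) powr b"
    using params by (intro ge_one_powr_ge_zero) auto
  then show ?thesis
    using params by (simp add: \<eta>_eq field_simps)
qed

lemma \<gamma>_powr: "\<gamma> k = \<gamma>0 * (real k + 1) powr - (1 / 2)"
  by (simp add: \<gamma>_eq powr_minus_divide powr_half_sqrt)

lemma \<eta>_powr: "\<eta> k = \<eta>0 * (real k + 1) powr - b"
  by (simp add: \<eta>_eq powr_minus_divide)

lemma \<gamma>_powr_r: "\<gamma> k powr r = \<gamma>0 powr r * (real k + 1) powr - (r / 2)"
  using params by (simp add: \<gamma>_powr powr_mult powr_powr)

lemma weight_div_\<gamma>: "\<gamma> k powr r / \<gamma> k = \<gamma>0 powr r / \<gamma>0 * (real k + 1) powr (1 / 2 - r / 2)"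
proof -
  have "(real k + 1) powr - (r / 2) / (real k + 1) powr - (1 / 2) = (real k + 1) powr (1 / 2 - r / 2)"
    unfolding powr_diff[symmetric] by (simp add: field_simps)
  then show ?thesis
    by (simp add: \<gamma>_powr_r) (simp add: \<gamma>_powr field_simps)
qed

lemma weight_mult_\<gamma>: "\<gamma> k powr r * \<gamma> k = \<gamma>0 powr r * \<gamma>0 * (real k + 1) powr - (1 / 2 + r / 2)"
proof -
  have "(real k + 1) powr - (r / 2) * (real k + 1) powr - (1 / 2) = (real k + 1) powr - (1 / 2 + r / 2)"
    unfolding powr_add[symmetric] by (simp add: add.commute)
  then show ?thesis
    by (simp add: \<gamma>_powr_r) (simp add: \<gamma>_powr field_simps)
qed

lemma weight_mult_\<eta>: "\<gamma> k powr r * \<eta> k = \<gamma>0 powr r * \<eta>0 * (real k + 1) powr - (r / 2 + b)"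
proof -
  have "(real k + 1) powr - (r / 2) * (real k + 1) powr - b = (real k + 1) powr - (r / 2 + b)"
    by (simp flip: powr_add)
  then show ?thesis
    by (simp add: \<gamma>_powr_r \<eta>_powr)
qed

lemma mono_weight_div_\<gamma>: "mono (\<lambda>k. \<gamma> k powr r / \<gamma> k)"
  unfolding weight_div_\<gamma> using r params by (intro monoI mult_left_mono powr_mono2) auto

lemma weight_div_\<eta>_\<gamma>_eq:
  "\<gamma> k powr r / \<eta> k / \<gamma> k
    = \<gamma>0 powr r / \<gamma>0 * (real k + 1) powr (1 / 2 - r / 2) * ((real k + 1) powr b / \<eta>0)"
proof -
  have "\<gamma> k powr r / \<eta> k / \<gamma> k = \<gamma> k powr r / \<gamma> k * ((real k + 1) powr b / \<eta>0)"
    by (simp add: \<eta>_eq field_simps)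
  then show ?thesis
    unfolding weight_div_\<gamma> .
qed

lemma mono_weight_div_\<eta>_\<gamma>: "mono (\<lambda>k. \<gamma> k powr r / \<eta> k / \<gamma> k)"
  unfolding weight_div_\<eta>_\<gamma>_eq using r params
  by (auto intro!: monoI mult_mono divide_right_mono powr_mono2)

text \<open>The weights decay with exponent \<open>\<alpha> = r / 2\<close>, and
  \<open>2 * (1 - \<alpha>)\<close> is the factor \<open>2 - r\<close> of the theorem. The threshold
  assumed on \<open>N\<close> dominates the one of \<open>sum_powr_minus_ge_half\<close> for this
  exponent.\<close>

lemma avg_weight_ge:
  assumes "2 powr (2 / (1 - r)) - 1 \<le> real N"
  shows "\<gamma>0 powr r * (real N + 1) powr (1 - r / 2) / (2 - r) \<le> avg_weight \<gamma> r N"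
proof -
  have "2 powr (1 / (1 - r / 2)) \<le> 2 powr (2 / (1 - r))"
    using r by (intro powr_mono) (auto simp: field_simps)
  with assms have "2 powr (1 / (1 - r / 2)) \<le> real N + 1"
    by linarith
  then have "(real N + 1) powr (1 - r / 2) / (2 * (1 - r / 2)) \<le> (\<Sum>k\<le>N. (real k + 1) powr - (r / 2))"
    using r by (intro sum_powr_minus_ge_half) auto
  then have "\<gamma>0 powr r * ((real N + 1) powr (1 - r / 2) / (2 * (1 - r / 2)))
      \<le> \<gamma>0 powr r * (\<Sum>k\<le>N. (real k + 1) powr - (r / 2))"
    by (rule mult_left_mono) simp
  then show ?thesis
    by (simp add: avg_weight_eq_sum \<gamma>_powr_r sum_distrib_left)
qed

text \<open>The shape to which all later bounds are brought, with the growth of the total weight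
  factored out. The lower bound on the weight may be multiplied by \<open>D\<close> only if
  \<open>D\<close> is nonnegative; a nonpositive \<open>D\<close> is settled by \<open>Q\<close>
  being nonnegative.\<close>

lemma le_if_avg_weight_mult_le:
  assumes N: "2 powr (2 / (1 - r)) - 1 \<le> real N"
    and D: "avg_weight \<gamma> r N * D \<le> \<gamma>0 powr r * (real N + 1) powr (1 - r / 2) * Q" and Q: "0 \<le> Q"
  shows "D \<le> (2 - r) * Q"
proof (cases "D \<le> 0")
  case True
  then show ?thesis using r Q by (simp add: order_trans[of D 0])
next
  case False
  define T where "T = \<gamma>0 powr r * (real N + 1) powr (1 - r / 2)"
  have T: "0 < T" using params by (simp add: T_def)
  have "T / (2 - r) * D \<le> avg_weight \<gamma> r N * D"
    using avg_weight_ge[OF N] False by (intro mult_right_mono) (auto simp: T_def)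
  with D have "T * (D / (2 - r)) \<le> T * Q"
    by (simp add: T_def)
  from mult_left_le_imp_le[OF this T] have "D / (2 - r) \<le> Q" .
  with r show ?thesis by (simp add: field_simps)
qed

lemma sum_weight_mult_\<gamma>_le:
  "(\<Sum>k\<le>N. \<gamma> k powr r * \<gamma> k * (CF\<^sup>2 + (\<eta> k)\<^sup>2 * Cf\<^sup>2))
    \<le> \<gamma>0 powr r * (real N + 1) powr (1 - r / 2)
      * (\<gamma>0 * (CF\<^sup>2 + \<eta>0\<^sup>2 * Cf\<^sup>2) / (0.5 - 0.5 * r) * (1 / (real N + 1) powr b))"
proof -
  let ?C = "CF\<^sup>2 + \<eta>0\<^sup>2 * Cf\<^sup>2"
  have "(\<eta> k)\<^sup>2 \<le> \<eta>0\<^sup>2" for k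
    using \<eta>_le \<eta>_pos by (intro power_mono) (auto intro: less_imp_le)
  then have "(\<Sum>k\<le>N. \<gamma> k powr r * \<gamma> k * (CF\<^sup>2 + (\<eta> k)\<^sup>2 * Cf\<^sup>2)) \<le> (\<Sum>k\<le>N. \<gamma> k powr r * \<gamma> k * ?C)"
    using \<gamma>_pos
    by (intro sum_mono mult_left_mono add_left_mono mult_right_mono mult_nonneg_nonneg)
      (auto intro: less_imp_le)
  also have "\<dots> = \<gamma>0 powr r * \<gamma>0 * ?C * (\<Sum>k\<le>N. (real k + 1) powr - (1 / 2 + r / 2))"
    unfolding weight_mult_\<gamma> sum_distrib_left by (simp add: mult_ac)
  also have "\<dots> \<le> \<gamma>0 powr r * \<gamma>0 * ?C * ((real N + 1) powr (1 - (1 / 2 + r / 2)) / (1 - (1 / 2 + r / 2)))"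
    using r params by (intro mult_left_mono sum_powr_minus_le) auto
  \<comment> \<open>As \<open>b < 1 / 2\<close> and the base is at least 1, the exponent
    \<open>1 / 2 - r / 2\<close> may grow to that of the regularization bias, so that all gap terms
    share one rate.\<close>
  also have "\<dots> \<le> \<gamma>0 powr r * \<gamma>0 * ?C * ((real N + 1) powr (1 - r / 2 - b) / (1 - (1 / 2 + r / 2)))"
    using r params by (intro mult_left_mono divide_right_mono powr_mono) auto
  also have "(real N + 1) powr (1 - r / 2 - b) = (real N + 1) powr (1 - r / 2) * (1 / (real N + 1) powr b)"
    by (simp add: powr_diff)
  finally show ?thesis
    by (simp add: mult_ac)
qed

lemma weight_div_\<eta>_\<gamma>:
  "\<gamma> k powr r / \<eta> k / \<gamma> k
    = \<gamma>0 powr r * (real k + 1) powr (1 - r / 2) * (1 / (\<gamma>0 * \<eta>0) * (1 / (real k + 1) powr (0.5 - b)))"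
proof -
  have "\<gamma> k powr r / \<eta> k / \<gamma> k
      = \<gamma>0 powr r / \<gamma>0 / \<eta>0 * ((real k + 1) powr (1 / 2 - r / 2) * (real k + 1) powr b)"
    unfolding weight_div_\<eta>_\<gamma>_eq by simp
  also have "(real k + 1) powr (1 / 2 - r / 2) * (real k + 1) powr b
      = (real k + 1) powr (1 - r / 2) * (1 / (real k + 1) powr (0.5 - b))"
    unfolding powr_minus_divide[symmetric] powr_add[symmetric]
    by (rule arg_cong[where f="(powr) _"]) simp
  finally show ?thesis by (simp add: mult_ac)
qed

lemma sum_weight_div_\<eta>_mult_\<gamma>_le:
  "(\<Sum>k\<le>N. \<gamma> k powr r / \<eta> k * \<gamma> k * (CF\<^sup>2 + (\<eta> k)\<^sup>2 * Cf\<^sup>2))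
    \<le> \<gamma>0 powr r * (real N + 1) powr (1 - r / 2)
      * (\<gamma>0 * (CF\<^sup>2 + \<eta>0\<^sup>2 * Cf\<^sup>2) / (0.5 - 0.5 * r + b) / \<eta>0 * (1 / (real N + 1) powr (0.5 - b)))"
proof -
  let ?C = "CF\<^sup>2 + \<eta>0\<^sup>2 * Cf\<^sup>2"
  \<comment> \<open>Division by \<open>\<eta> k\<close> lowers the decay exponent by
    \<open>b\<close>. The constraints on \<open>r\<close> and \<open>b\<close> keep it in
    \<open>[0, 1)\<close>, and \<open>1 - ?\<beta>\<close> is the denominator
    \<open>0.5 - 0.5 * r + b\<close> of the theorem.\<close>
  let ?\<beta> = "(1 / 2 + r / 2) - b"
  have weight: "\<gamma> k powr r / \<eta> k * \<gamma> k = \<gamma>0 powr r * \<gamma>0 / \<eta>0 * (real k + 1) powr - ?\<beta>" for k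
  proof -
    have "\<gamma> k powr r / \<eta> k * \<gamma> k
        = \<gamma>0 powr r * \<gamma>0 / \<eta>0 * ((real k + 1) powr - (1 / 2 + r / 2) * (real k + 1) powr b)"
      using weight_mult_\<gamma>[of k] by (simp add: \<eta>_eq)
    also have "(real k + 1) powr - (1 / 2 + r / 2) * (real k + 1) powr b = (real k + 1) powr - ?\<beta>"
      unfolding powr_add[symmetric] by (rule arg_cong[where f="(powr) _"]) simp
    finally show ?thesis .
  qed
  have "(\<eta> k)\<^sup>2 \<le> \<eta>0\<^sup>2" for k
    using \<eta>_le \<eta>_pos by (intro power_mono) (auto intro: less_imp_le)
  then have "(\<Sum>k\<le>N. \<gamma> k powr r / \<eta> k * \<gamma> k * (CF\<^sup>2 + (\<eta> k)\<^sup>2 * Cf\<^sup>2))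
      \<le> (\<Sum>k\<le>N. \<gamma> k powr r / \<eta> k * \<gamma> k * ?C)"
    using \<gamma>_pos \<eta>_pos
    by (intro sum_mono mult_left_mono add_left_mono mult_right_mono mult_nonneg_nonneg divide_nonneg_pos)
      (auto intro: less_imp_le)
  also have "\<dots> = \<gamma>0 powr r * \<gamma>0 / \<eta>0 * ?C * (\<Sum>k\<le>N. (real k + 1) powr - ?\<beta>)"
    unfolding weight sum_distrib_left by (simp add: mult_ac)
  also have "\<dots> \<le> \<gamma>0 powr r * \<gamma>0 / \<eta>0 * ?C * ((real N + 1) powr (1 - ?\<beta>) / (1 - ?\<beta>))"
    using r params by (intro mult_left_mono sum_powr_minus_le) auto
  also have "(real N + 1) powr (1 - ?\<beta>) = (real N + 1) powr (1 - r / 2) * (1 / (real N + 1) powr (0.5 - b))"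
    unfolding powr_minus_divide[symmetric] powr_add[symmetric]
    by (rule arg_cong[where f="(powr) _"]) simp
  also have "1 - ?\<beta> = 0.5 - 0.5 * r + b"
    by (simp add: field_simps)
  finally show ?thesis
    by (simp add: mult_ac)
qed

lemma weight_div_\<gamma>_le:
  "\<gamma> k powr r / \<gamma> k
    \<le> \<gamma>0 powr r * (real k + 1) powr (1 - r / 2) * (1 / \<gamma>0 * (1 / (real k + 1) powr b))"
proof -
  have "(real k + 1) powr (1 / 2 - r / 2) \<le> (real k + 1) powr (1 - r / 2 - b)"
    using params by (intro powr_mono) (auto simp: field_simps)
  also have "\<dots> = (real k + 1) powr (1 - r / 2) * (1 / (real k + 1) powr b)"
    by (simp add: powr_diff)
  finally have "\<gamma>0 powr r / \<gamma>0 * (real k + 1) powr (1 / 2 - r / 2)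
      \<le> \<gamma>0 powr r / \<gamma>0 * ((real k + 1) powr (1 - r / 2) * (1 / (real k + 1) powr b))"
    using params by (intro mult_left_mono) auto
  then show ?thesis
    unfolding weight_div_\<gamma> by simp
qed

text \<open>The regularization bias, the term that dictates the rate of the gap; its decay exponent
  \<open>r / 2 + b\<close> stays below 1.\<close>

lemma sum_weight_mult_\<eta>_le:
  "(\<Sum>k\<le>N. \<gamma> k powr r * \<eta> k)
    \<le> \<gamma>0 powr r * (real N + 1) powr (1 - r / 2)
      * (\<eta>0 / (1 - 0.5 * r - b) * (1 / (real N + 1) powr b))"
proof -
  have "(\<Sum>k\<le>N. \<gamma> k powr r * \<eta> k) = \<gamma>0 powr r * \<eta>0 * (\<Sum>k\<le>N. (real k + 1) powr - (r / 2 + b))"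
    by (simp only: weight_mult_\<eta> sum_distrib_left)
  also have "\<dots> \<le> \<gamma>0 powr r * \<eta>0 * ((real N + 1) powr (1 - (r / 2 + b)) / (1 - (r / 2 + b)))"
    using r params by (intro mult_left_mono sum_powr_minus_le) auto
  also have "(real N + 1) powr (1 - (r / 2 + b)) = (real N + 1) powr (1 - r / 2) * (1 / (real N + 1) powr b)"
    unfolding powr_minus_divide[symmetric] powr_add[symmetric]
    by (rule arg_cong[where f="(powr) _"]) simp
  also have "1 - (r / 2 + b) = 1 - 0.5 * r - b"
    by simp
  finally show ?thesis
    by (simp add: mult_ac)
qed

end

subsection \<open>Convergence rates\<close>

theorem theorem3p3:
  fixes blk :: "'n::finite \<Rightarrow> 'd::finite"
    and Xs :: "'d \<Rightarrow> (real ^ 'n) set"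
    and X :: "(real ^ 'n) set"
    and f :: "real ^ 'n \<Rightarrow> real"
    and F sg :: "real ^ 'n \<Rightarrow> real ^ 'n"
    and M Cf CF \<gamma>0 \<eta>0 b r pmin :: real
    and \<gamma> \<eta> :: "nat \<Rightarrow> real"
    and p :: "'d \<Rightarrow> real"
    and P :: "'w measure"
    and x0 :: "'w \<Rightarrow> real ^ 'n"
    and i :: "nat \<Rightarrow> 'w \<Rightarrow> 'd"
    and x xbar :: "'w \<Rightarrow> nat \<Rightarrow> real ^ 'n"
  assumes Xs: "\<And>j. Xs j \<subseteq> block_space blk j" "\<And>j. Xs j \<noteq> {}" "\<And>j. closed (Xs j)" "\<And>j. convex (Xs j)"
    and X_def: "X = block_prod blk Xs"
    and M: "M > 0" "\<And>z. z \<in> X \<Longrightarrow> norm z \<le> M"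
    and f: "convex_on UNIV f"
    and sg: "\<And>z. sg z \<in> subdifferential f z"
    and Cf: "Cf > 0" "\<And>z g. z \<in> X \<Longrightarrow> g \<in> subdifferential f z \<Longrightarrow> norm g \<le> Cf"
    and F: "continuous_on X F" "monotone_map_on X F"
    and CF: "CF > 0" "\<And>z. z \<in> X \<Longrightarrow> norm (F z) \<le> CF"
    and opt_nonempty: "optimal_solutions f X F \<noteq> {}"
    and p: "\<And>j. p j > 0" "(\<Sum>j\<in>UNIV. p j) = 1"
    and pmin_def: "pmin = Min (range p)"
    and r: "0 \<le> r" "r < 1"
    and params: "\<gamma>0 > 0" "\<eta>0 > 0" "0 < b" "b < 0.5"
    and \<gamma>_def: "\<And>k. \<gamma> k = \<gamma>0 / sqrt (real k + 1)"
    and \<eta>_def: "\<And>k. \<eta> k = \<eta>0 / (real k + 1) powr b"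
    and P: "prob_space P"
    and x0: "x0 \<in> borel_measurable P" "\<And>\<omega>. \<omega> \<in> space P \<Longrightarrow> x0 \<omega> \<in> X"
    and i_indep: "prob_space.indep_vars P (\<lambda>_. count_space UNIV) i UNIV"
    and i_distr: "\<And>k j. measure P {\<omega> \<in> space P. i k \<omega> = j} = p j"
    and x0_indep: "indep_of P borel x0 (\<Pi>\<^sub>M k\<in>UNIV. count_space UNIV) (\<lambda>\<omega> k. i k \<omega>)"
    and x_def: "\<And>\<omega>. x \<omega> = arb_irg_iter blk Xs F sg \<gamma> \<eta> (x0 \<omega>) (\<lambda>k. i k \<omega>)"
    and xbar_def: "\<And>\<omega>. xbar \<omega> = weighted_avg \<gamma> r (x \<omega>)"
    and sg_measurable: "\<And>k. (\<lambda>\<omega>. sg (x \<omega> k)) \<in> borel_measurable (history P x0 i k)"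
  shows "(\<forall>xs \<in> optimal_solutions f X F. \<forall>N::nat. real N \<ge> 2 powr (2 / (1 - r)) - 1 \<longrightarrow>
            (\<integral>\<omega>. f (xbar \<omega> N) \<partial>P) - f xs
              \<le> (2 - r) / (pmin * \<eta>0)
                  * (4 * M\<^sup>2 / \<gamma>0 + \<gamma>0 * (CF\<^sup>2 + \<eta>0\<^sup>2 * Cf\<^sup>2) / (0.5 - 0.5 * r + b))
                  * (1 / (real N + 1) powr (0.5 - b)))
       \<and> (\<forall>N::nat. real N \<ge> 2 powr (2 / (1 - r)) - 1 \<longrightarrow>
            (\<integral>\<omega>. GAP X F (xbar \<omega> N) \<partial>P)
              \<le> (2 - r) / pmin
                  * (4 * M\<^sup>2 / \<gamma>0 + \<gamma>0 * (CF\<^sup>2 + \<eta>0\<^sup>2 * Cf\<^sup>2) / (0.5 - 0.5 * r)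
                      + 2 * pmin * Cf * M * \<eta>0 / (1 - 0.5 * r - b))
                  * (1 / (real N + 1) powr b))"
proof -
  have pmin_pos: "0 < pmin"
    unfolding pmin_def using p(1) by (subst Min_gr_iff) auto
  have pmin_le: "pmin \<le> p j" for j
    unfolding pmin_def by (intro Min_le) auto
  have sg_bound: "norm (sg z) \<le> Cf" if "z \<in> X" for z
    using Cf(2) that sg by blast
  interpret power_schedule \<gamma> \<eta> \<gamma>0 \<eta>0 b r
    using r params \<gamma>_def \<eta>_def by unfold_locales auto
  interpret arb_irg P blk Xs F sg M Cf CF pmin \<gamma> \<eta> p x0 i x
    by (intro arb_irg.intro arb_irg_axioms.intro P; (unfold X_def[symmetric])?)
      (fact Xs M(2) F(1) CF(2) sg_bound pmin_pos pmin_le p(2) \<gamma>_pos less_imp_le[OF \<eta>_pos]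
        x0 i_indep i_distr x0_indep x_def sg_measurable)+
  have Xbar: "xbar \<omega> = weighted_avg \<gamma> r (x \<omega>)" for \<omega>
    by (rule xbar_def)
  have mono_F: "monotone_map_on (block_prod blk Xs) F"
    using F(2) by (simp add: X_def)
  let ?C = "CF\<^sup>2 + \<eta>0\<^sup>2 * Cf\<^sup>2"
  let ?T = "\<lambda>N. \<gamma>0 powr r * (real N + 1) powr (1 - r / 2)"
  \<comment> \<open>Stated for arbitrary \<open>T\<close>, \<open>w\<close>, \<open>c\<close>,
    \<open>d\<close>, so that simplification treats the powers and denominators of the schedule as
    atoms.\<close>
  have eq1: "T * (1 / (\<gamma>0 * \<eta>0) * w) * (4 * M\<^sup>2 / pmin) + T * (c / d / \<eta>0 * w) / pmin
      = T * (1 / (pmin * \<eta>0) * (4 * M\<^sup>2 / \<gamma>0 + c / d) * w)" for T w c d :: real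
    by (simp add: algebra_simps)
  have eq2: "T * (1 / \<gamma>0 * w) * (4 * M\<^sup>2 / pmin) + T * (c * w) / pmin + T * (\<eta>0 / d * w) * (2 * Cf * M)
      = T * (1 / pmin * (4 * M\<^sup>2 / \<gamma>0 + c + 2 * pmin * Cf * M * \<eta>0 / d) * w)" for T w c d :: real
    using pmin_pos by (simp add: algebra_simps)
  show ?thesis
  proof (intro conjI ballI allI impI)
    fix xs N assume "xs \<in> optimal_solutions f X F" and N: "2 powr (2 / (1 - r)) - 1 \<le> real N"
    then have xs: "xs \<in> SOL (block_prod blk Xs) F"
      by (simp add: optimal_solutions_def is_arg_min_def X_def)
    let ?w = "1 / (real N + 1) powr (0.5 - b)"
    let ?Q = "1 / (pmin * \<eta>0) * (4 * M\<^sup>2 / \<gamma>0 + \<gamma>0 * ?C / (0.5 - 0.5 * r + b)) * ?w"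
    have "avg_weight \<gamma> r N * ((\<integral>\<omega>. f (xbar \<omega> N) \<partial>P) - f xs)
        \<le> \<gamma> N powr r / \<eta> N / \<gamma> N * (4 * M\<^sup>2 / pmin)
          + (\<Sum>k\<le>N. \<gamma> k powr r / \<eta> k * \<gamma> k * (CF\<^sup>2 + (\<eta> k)\<^sup>2 * Cf\<^sup>2)) / pmin"
      unfolding Xbar by (rule expectation_fun_le[OF f sg mono_F xs \<eta>_pos mono_weight_div_\<eta>_\<gamma>])
    also have "\<dots> \<le> ?T N * (1 / (\<gamma>0 * \<eta>0) * ?w) * (4 * M\<^sup>2 / pmin)
        + ?T N * (\<gamma>0 * ?C / (0.5 - 0.5 * r + b) / \<eta>0 * ?w) / pmin"
      unfolding weight_div_\<eta>_\<gamma> using pmin_pos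
      by (intro add_left_mono divide_right_mono sum_weight_div_\<eta>_mult_\<gamma>_le) simp
    also have "\<dots> = ?T N * ?Q"
      by (rule eq1)
    finally have "(\<integral>\<omega>. f (xbar \<omega> N) \<partial>P) - f xs \<le> (2 - r) * ?Q"
      using pmin_pos params r by (intro le_if_avg_weight_mult_le[OF N]) auto
    then show "(\<integral>\<omega>. f (xbar \<omega> N) \<partial>P) - f xs
        \<le> (2 - r) / (pmin * \<eta>0) * (4 * M\<^sup>2 / \<gamma>0 + \<gamma>0 * ?C / (0.5 - 0.5 * r + b)) * ?w"
      by (simp only: times_divide_eq_right mult_1_right mult.assoc[symmetric])
  next
    fix N assume N: "2 powr (2 / (1 - r)) - 1 \<le> real N"
    let ?w = "1 / (real N + 1) powr b"
    let ?Q = "1 / pmin * (4 * M\<^sup>2 / \<gamma>0 + \<gamma>0 * ?C / (0.5 - 0.5 * r)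
        + 2 * pmin * Cf * M * \<eta>0 / (1 - 0.5 * r - b)) * ?w"
    have "avg_weight \<gamma> r N * (\<integral>\<omega>. GAP X F (xbar \<omega> N) \<partial>P)
        \<le> \<gamma> N powr r / \<gamma> N * (4 * M\<^sup>2 / pmin)
          + (\<Sum>k\<le>N. \<gamma> k powr r * \<gamma> k * (CF\<^sup>2 + (\<eta> k)\<^sup>2 * Cf\<^sup>2)) / pmin
          + (\<Sum>k\<le>N. \<gamma> k powr r * \<eta> k) * (2 * Cf * M)"
      unfolding Xbar X_def by (rule expectation_GAP_le[OF mono_F mono_weight_div_\<gamma>])
    also have "\<dots> \<le> ?T N * (1 / \<gamma>0 * ?w) * (4 * M\<^sup>2 / pmin)
        + ?T N * (\<gamma>0 * ?C / (0.5 - 0.5 * r) * ?w) / pmin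
        + ?T N * (\<eta>0 / (1 - 0.5 * r - b) * ?w) * (2 * Cf * M)"
      using pmin_pos Cf(1) M(1)
      by (intro add_mono mult_right_mono divide_right_mono weight_div_\<gamma>_le sum_weight_mult_\<gamma>_le
          sum_weight_mult_\<eta>_le) auto
    also have "\<dots> = ?T N * ?Q"
      by (rule eq2)
    finally have "(\<integral>\<omega>. GAP X F (xbar \<omega> N) \<partial>P) \<le> (2 - r) * ?Q"
      using pmin_pos params r Cf(1) M(1) by (intro le_if_avg_weight_mult_le[OF N]) auto
    then show "(\<integral>\<omega>. GAP X F (xbar \<omega> N) \<partial>P)
        \<le> (2 - r) / pmin * (4 * M\<^sup>2 / \<gamma>0 + \<gamma>0 * ?C / (0.5 - 0.5 * r)
            + 2 * pmin * Cf * M * \<eta>0 / (1 - 0.5 * r - b)) * ?w"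
      by (simp only: times_divide_eq_right mult_1_right mult.assoc[symmetric])
  qed
qed

end
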